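(* Let $\mathbb{D}$ be a pointed derivator. (i) Let $u\colon J\to K$ be a cosieve (between small categories). Then the homotopy left Kan extension functor $u_!\colon\mathbb{D}(J)\to\mathbb{D}(K)$ is fully faithful, and $X\in\mathbb{D}(K)$ lies in the essential image of $u_!$ if and only if $X_k\cong0$ for all $k\in K-u(J)$. (ii) Let $u\colon J\to K$ be a sieve (between small categories). Then the homotopy right Kan extension functor $u_\ast\colon\mathbb{D}(J)\to\mathbb{D}(K)$ is fully faithful, and $X\in\mathbb{D}(K)$ lies in the essential image of $u_\ast$ if and only if $X_k\cong0$ for all $k\in K-u(J)$.
   Context: $\mathsf{Cat}$ is the 2-category of small categories, $\mathsf{CAT}$ that of not necessarily small categories, $e$ the terminal category. A prederivator is a strict 2-functor $\mathbb{D}\colon\mathsf{Cat}^{op}\to\mathsf{CAT}$ (contravariant on functors, covariant on natural transformations). Write $u^\ast=\mathbb{D}(u)\colon\mathbb{D}(K)\to\mathbb{D}(J)$ for $u\colon J\to K$, and $\alpha^\ast=\mathbb{D}(\alpha)$. For $k\in K$, viewed as $k\colon e\to K$, write $X_k=k^\ast X\in\mathbb{D}(e)$, $f_k=k^\ast f$. $\mathbb{D}$ is a derivator if: (Der1) for all $J_1,J_2$ the functor $\mathbb{D}(J_1\sqcup J_2)\to\mathbb{D}(J_1)\times\mathbb{D}(J_2)$ induced by the inclusions is an equivalence, and $\mathbb{D}(\emptyset)$ is not the empty category; (Der2) a morphism $f$ in $\mathbb{D}(J)$ is an isomorphism iff $f_j$ is an isomorphism in $\mathbb{D}(e)$ for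 all $j\in J$; (Der3) every $u^\ast$ has a left adjoint $u_!$ and a right adjoint $u_\ast$ (homotopy left/right Kan extension); (Der4) for $u\colon J\to K$ and $k\in K$ let $J_{/k}$ be the category of pairs $(j,f\colon u(j)\to k)$ and $J_{k/}$ that of pairs $(j,f\colon k\to u(j))$, with projections $\mathrm{pr}$ to $J$ and $p$ to $e$, and let $\alpha\colon u\circ\mathrm{pr}\to k\circ p$, resp. $\alpha\colon k\circ p\to u\circ\mathrm{pr}$, be the transformation with components $f$. Then the maps $p_!\mathrm{pr}^\ast\xrightarrow{\eta}p_!\mathrm{pr}^\ast u^\ast u_!\xrightarrow{\alpha^\ast}p_!p^\ast k^\ast u_!\xrightarrow{\epsilon}k^\ast u_!$ and $k^\ast u_\ast\xrightarrow{\eta}p_\ast p^\ast k^\ast u_\ast\xrightarrow{\alpha^\ast}p_\ast\mathrm{pr}^\ast u^\ast u_\ast\xrightarrow{\epsilon}p_\ast\mathrm{pr}^\ast$ are isomorphisms. A derivator $\mathbb{D}$ is pointed if the category $\mathbb{D}(e)$ has a zero object $0$. A fully faithful functor $u\colon J\to K$ that is injective on objects is a cosieve if, whenever there is a morphism $u(j)\to k$ in $K$, $k$ lies in the image of $u$; it is a sieve if, whenever there is a morphism $k\to u(j)$ in $K$, $k$ lies in the image of $u$. $K-u(J)$ denotes the objects of $K$ not in the image of $u$. *)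

theory Defs
  imports "HOL-Library.FuncSet" "HOL-Library.Infinite_Typeclass"
begin

section \<open>Categories, functors, natural transformations\<close>

text \<open>
  A category has a set of objects and a set of arrows inside two types.  All structure maps are
  required to be undefined outside their domain, and likewise for the maps underlying functors and
  natural transformations.  Hence HOL equality of these records is equality of categories (functors,
  transformations), which is what strictness of a 2-functor refers to.
\<close>

record ('o, 'm) cat =
  Obj :: "'o set"
  Arr :: "'m set"
  Dom :: "'m \<Rightarrow> 'o"
  Cod :: "'m \<Rightarrow> 'o"
  Ident :: "'o \<Rightarrow> 'm"
  Comp :: "'m \<Rightarrow> 'm \<Rightarrow> 'm"  (infixr "\<cdot>\<index>" 70)

text \<open>Composition is in applicative order: \<open>g \<cdot>\<^bsub>C\<^esub> f\<close> is \<open>f\<close> followed by \<open>g\<close>.\<close>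

definition Hom :: "('o, 'm, 'z) cat_scheme \<Rightarrow> 'o \<Rightarrow> 'o \<Rightarrow> 'm set" where
  "Hom C a b = {f \<in> Arr C. Dom C f = a \<and> Cod C f = b}"

locale category =
  fixes C :: "('o, 'm) cat" (structure)
  assumes Dom_Obj: "Dom C \<in> Arr C \<rightarrow>\<^sub>E Obj C"
    and Cod_Obj: "Cod C \<in> Arr C \<rightarrow>\<^sub>E Obj C"
    and Ident_Hom: "a \<in> Obj C \<Longrightarrow> Ident C a \<in> Hom C a a"
    and Ident_ext: "Ident C \<in> extensional (Obj C)"
    and Comp_Hom: "f \<in> Hom C a b \<Longrightarrow> g \<in> Hom C b c \<Longrightarrow> g \<cdot> f \<in> Hom C a c"
    and Comp_ext: "\<not> (f \<in> Arr C \<and> g \<in> Arr C \<and> Dom C g = Cod C f) \<Longrightarrow> g \<cdot> f = undefined"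
    and Comp_Ident_left: "f \<in> Hom C a b \<Longrightarrow> Ident C b \<cdot> f = f"
    and Comp_Ident_right: "f \<in> Hom C a b \<Longrightarrow> f \<cdot> Ident C a = f"
    and Comp_assoc: "f \<in> Hom C a b \<Longrightarrow> g \<in> Hom C b c \<Longrightarrow> h \<in> Hom C c d \<Longrightarrow>
      h \<cdot> (g \<cdot> f) = (h \<cdot> g) \<cdot> f"

text \<open>The following constructors truncate the given maps so that they are undefined outside their
  domain.\<close>

definition mk_cat ::
  "'o set \<Rightarrow> 'm set \<Rightarrow> ('m \<Rightarrow> 'o) \<Rightarrow> ('m \<Rightarrow> 'o) \<Rightarrow> ('o \<Rightarrow> 'm) \<Rightarrow> ('m \<Rightarrow> 'm \<Rightarrow> 'm) \<Rightarrow> ('o, 'm) cat" where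
  "mk_cat Ob Ar d c i m =
    \<lparr> Obj = Ob, Arr = Ar, Dom = restrict d Ar, Cod = restrict c Ar, Ident = restrict i Ob,
      Comp = (\<lambda>g f. if f \<in> Ar \<and> g \<in> Ar \<and> d g = c f then m g f else undefined) \<rparr>"

record ('a, 'b, 'c, 'd) func =
  Src :: "('a, 'b) cat"
  Tgt :: "('c, 'd) cat"
  OMap :: "'a \<Rightarrow> 'c"
  AMap :: "'b \<Rightarrow> 'd"

definition mk_func ::
  "('a, 'b) cat \<Rightarrow> ('c, 'd) cat \<Rightarrow> ('a \<Rightarrow> 'c) \<Rightarrow> ('b \<Rightarrow> 'd) \<Rightarrow> ('a, 'b, 'c, 'd) func" where
  "mk_func A B f g =
    \<lparr> Src = A, Tgt = B, OMap = restrict f (Obj A), AMap = restrict g (Arr A) \<rparr>"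

definition is_functor ::
  "('a, 'b, 'c, 'd) func \<Rightarrow> ('a, 'b) cat \<Rightarrow> ('c, 'd) cat \<Rightarrow> bool" where
  "is_functor F A B \<longleftrightarrow>
    category A \<and> category B \<and> Src F = A \<and> Tgt F = B \<and>
    OMap F \<in> Obj A \<rightarrow>\<^sub>E Obj B \<and> AMap F \<in> extensional (Arr A) \<and>
    (\<forall>a\<in>Obj A. \<forall>b\<in>Obj A. \<forall>f\<in>Hom A a b. AMap F f \<in> Hom B (OMap F a) (OMap F b)) \<and>
    (\<forall>a\<in>Obj A. AMap F (Ident A a) = Ident B (OMap F a)) \<and>
    (\<forall>a\<in>Obj A. \<forall>b\<in>Obj A. \<forall>c\<in>Obj A. \<forall>f\<in>Hom A a b. \<forall>g\<in>Hom A b c.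
      AMap F (g \<cdot>\<^bsub>A\<^esub> f) = AMap F g \<cdot>\<^bsub>B\<^esub> AMap F f)"

definition id_func :: "('a, 'b) cat \<Rightarrow> ('a, 'b, 'a, 'b) func" where
  "id_func A = mk_func A A (\<lambda>x. x) (\<lambda>f. f)"

definition comp_func ::
  "('c, 'd, 'e, 'f) func \<Rightarrow> ('a, 'b, 'c, 'd) func \<Rightarrow> ('a, 'b, 'e, 'f) func"
  (infixr "\<circ>\<^sub>F" 75) where
  "G \<circ>\<^sub>F F = mk_func (Src F) (Tgt G) (OMap G \<circ> OMap F) (AMap G \<circ> AMap F)"

record ('a, 'b, 'c, 'd) nat_tr =
  NSrc :: "('a, 'b, 'c, 'd) func"
  NTgt :: "('a, 'b, 'c, 'd) func"
  Cmp :: "'a \<Rightarrow> 'd"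

definition mk_nat ::
  "('a, 'b, 'c, 'd) func \<Rightarrow> ('a, 'b, 'c, 'd) func \<Rightarrow> ('a \<Rightarrow> 'd) \<Rightarrow> ('a, 'b, 'c, 'd) nat_tr" where
  "mk_nat F G t = \<lparr> NSrc = F, NTgt = G, Cmp = restrict t (Obj (Src F)) \<rparr>"

definition is_nat ::
  "('a, 'b, 'c, 'd) nat_tr \<Rightarrow> ('a, 'b, 'c, 'd) func \<Rightarrow> ('a, 'b, 'c, 'd) func \<Rightarrow>
   ('a, 'b) cat \<Rightarrow> ('c, 'd) cat \<Rightarrow> bool" where
  "is_nat \<tau> F G A B \<longleftrightarrow>
    is_functor F A B \<and> is_functor G A B \<and> NSrc \<tau> = F \<and> NTgt \<tau> = G \<and>
    Cmp \<tau> \<in> extensional (Obj A) \<and>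
    (\<forall>a\<in>Obj A. Cmp \<tau> a \<in> Hom B (OMap F a) (OMap G a)) \<and>
    (\<forall>a\<in>Obj A. \<forall>b\<in>Obj A. \<forall>f\<in>Hom A a b.
      Cmp \<tau> b \<cdot>\<^bsub>B\<^esub> AMap F f = AMap G f \<cdot>\<^bsub>B\<^esub> Cmp \<tau> a)"

definition id_nat :: "('a, 'b, 'c, 'd) func \<Rightarrow> ('a, 'b, 'c, 'd) nat_tr" where
  "id_nat F = mk_nat F F (\<lambda>a. Ident (Tgt F) (OMap F a))"

definition vcomp ::
  "('a, 'b, 'c, 'd) nat_tr \<Rightarrow> ('a, 'b, 'c, 'd) nat_tr \<Rightarrow> ('a, 'b, 'c, 'd) nat_tr"
  (infixr "\<bullet>\<^sub>v" 65) where
  "\<tau> \<bullet>\<^sub>v \<sigma> = mk_nat (NSrc \<sigma>) (NTgt \<tau>) (\<lambda>a. Cmp \<tau> a \<cdot>\<^bsub>Tgt (NSrc \<sigma>)\<^esub> Cmp \<sigma> a)"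

definition hcomp ::
  "('c, 'd, 'e, 'f) nat_tr \<Rightarrow> ('a, 'b, 'c, 'd) nat_tr \<Rightarrow> ('a, 'b, 'e, 'f) nat_tr"
  (infixr "\<star>" 70) where
  "\<tau> \<star> \<sigma> = mk_nat (NSrc \<tau> \<circ>\<^sub>F NSrc \<sigma>) (NTgt \<tau> \<circ>\<^sub>F NTgt \<sigma>)
    (\<lambda>a. Cmp \<tau> (OMap (NTgt \<sigma>) a) \<cdot>\<^bsub>Tgt (NSrc \<tau>)\<^esub> AMap (NSrc \<tau>) (Cmp \<sigma> a))"

definition is_iso :: "('o, 'm) cat \<Rightarrow> 'm \<Rightarrow> bool" where
  "is_iso C f \<longleftrightarrow> (\<exists>a\<in>Obj C. \<exists>b\<in>Obj C. f \<in> Hom C a b \<and>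
    (\<exists>g\<in>Hom C b a. g \<cdot>\<^bsub>C\<^esub> f = Ident C a \<and> f \<cdot>\<^bsub>C\<^esub> g = Ident C b))"

definition isomorphic :: "('o, 'm) cat \<Rightarrow> 'o \<Rightarrow> 'o \<Rightarrow> bool" where
  "isomorphic C a b \<longleftrightarrow> (\<exists>f\<in>Hom C a b. is_iso C f)"

definition zero_object :: "('o, 'm) cat \<Rightarrow> 'o \<Rightarrow> bool" where
  "zero_object C z \<longleftrightarrow> z \<in> Obj C \<and>
    (\<forall>a\<in>Obj C. (\<exists>!f. f \<in> Hom C z a) \<and> (\<exists>!f. f \<in> Hom C a z))"

definition is_nat_iso ::
  "('a, 'b, 'c, 'd) nat_tr \<Rightarrow> ('a, 'b, 'c, 'd) func \<Rightarrow> ('a, 'b, 'c, 'd) func \<Rightarrow>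
   ('a, 'b) cat \<Rightarrow> ('c, 'd) cat \<Rightarrow> bool" where
  "is_nat_iso \<tau> F G A B \<longleftrightarrow> is_nat \<tau> F G A B \<and> (\<forall>a\<in>Obj A. is_iso B (Cmp \<tau> a))"

definition is_equivalence ::
  "('a, 'b, 'c, 'd) func \<Rightarrow> ('a, 'b) cat \<Rightarrow> ('c, 'd) cat \<Rightarrow> bool" where
  "is_equivalence F A B \<longleftrightarrow> is_functor F A B \<and>
    (\<exists>G \<eta> \<epsilon>. is_functor G B A \<and>
      is_nat_iso \<eta> (id_func A) (G \<circ>\<^sub>F F) A A \<and> is_nat_iso \<epsilon> (F \<circ>\<^sub>F G) (id_func B) B B)"

definition fully_faithful :: "('a, 'b, 'c, 'd) func \<Rightarrow> bool" where
  "fully_faithful F \<longleftrightarrow> (\<forall>a\<in>Obj (Src F). \<forall>b\<in>Obj (Src F).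
    bij_betw (AMap F) (Hom (Src F) a b) (Hom (Tgt F) (OMap F a) (OMap F b)))"

definition essential_image :: "('a, 'b, 'c, 'd) func \<Rightarrow> 'c set" where
  "essential_image F = {x \<in> Obj (Tgt F). \<exists>a\<in>Obj (Src F). isomorphic (Tgt F) (OMap F a) x}"

text \<open>\<open>L : A \<rightarrow> B\<close> is left adjoint to \<open>R : B \<rightarrow> A\<close> with unit \<open>\<eta>\<close> and counit \<open>\<epsilon>\<close>.\<close>

definition adjunction ::
  "('a, 'b) cat \<Rightarrow> ('c, 'd) cat \<Rightarrow> ('a, 'b, 'c, 'd) func \<Rightarrow> ('c, 'd, 'a, 'b) func \<Rightarrow>
   ('a, 'b, 'a, 'b) nat_tr \<Rightarrow> ('c, 'd, 'c, 'd) nat_tr \<Rightarrow> bool" where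
  "adjunction A B L R \<eta> \<epsilon> \<longleftrightarrow>
    is_functor L A B \<and> is_functor R B A \<and>
    is_nat \<eta> (id_func A) (R \<circ>\<^sub>F L) A A \<and> is_nat \<epsilon> (L \<circ>\<^sub>F R) (id_func B) B B \<and>
    (\<forall>a\<in>Obj A. Cmp \<epsilon> (OMap L a) \<cdot>\<^bsub>B\<^esub> AMap L (Cmp \<eta> a) = Ident B (OMap L a)) \<and>
    (\<forall>b\<in>Obj B. AMap R (Cmp \<epsilon> b) \<cdot>\<^bsub>A\<^esub> Cmp \<eta> (OMap R b) = Ident A (OMap R b))"

definition sieve :: "('a, 'b, 'c, 'd) func \<Rightarrow> bool" where
  "sieve u \<longleftrightarrow> fully_faithful u \<and> inj_on (OMap u) (Obj (Src u)) \<and>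
    (\<forall>j\<in>Obj (Src u). \<forall>k\<in>Obj (Tgt u).
      Hom (Tgt u) k (OMap u j) \<noteq> {} \<longrightarrow> k \<in> OMap u ` Obj (Src u))"

definition cosieve :: "('a, 'b, 'c, 'd) func \<Rightarrow> bool" where
  "cosieve u \<longleftrightarrow> fully_faithful u \<and> inj_on (OMap u) (Obj (Src u)) \<and>
    (\<forall>j\<in>Obj (Src u). \<forall>k\<in>Obj (Tgt u).
      Hom (Tgt u) (OMap u j) k \<noteq> {} \<longrightarrow> k \<in> OMap u ` Obj (Src u))"

definition prod_cat :: "('a, 'b) cat \<Rightarrow> ('c, 'd) cat \<Rightarrow> ('a \<times> 'c, 'b \<times> 'd) cat" where
  "prod_cat A B = mk_cat (Obj A \<times> Obj B) (Arr A \<times> Arr B)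
    (map_prod (Dom A) (Dom B)) (map_prod (Cod A) (Cod B)) (map_prod (Ident A) (Ident B))
    (\<lambda>g f. (fst g \<cdot>\<^bsub>A\<^esub> fst f, snd g \<cdot>\<^bsub>B\<^esub> snd f))"

definition pair_func ::
  "('a, 'b, 'c, 'd) func \<Rightarrow> ('a, 'b, 'e, 'f) func \<Rightarrow> ('a, 'b, 'c \<times> 'e, 'd \<times> 'f) func" where
  "pair_func F G = mk_func (Src F) (prod_cat (Tgt F) (Tgt G))
    (\<lambda>x. (OMap F x, OMap G x)) (\<lambda>f. (AMap F f, AMap G f))"

section \<open>Small categories\<close>

text \<open>
  Objects and arrows of small categories are elements of a fixed infinite type \<open>'u\<close>, and \<open>small\<close> says
  which subsets of \<open>'u\<close> are small.  Only the closure properties needed to form the small categories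
  occurring in the axioms of a derivator (finite sums, comma categories) are required.  They hold for
  the sets that are elements of a Grothendieck universe \<open>'u\<close>, for the sets of cardinality
  below a regular cardinal, and for the family of all subsets of \<open>'u\<close>.
\<close>

locale universe =
  fixes small :: "'u :: infinite set \<Rightarrow> bool"
  assumes small_subset: "small A \<Longrightarrow> B \<subseteq> A \<Longrightarrow> small B"
    and small_image: "small A \<Longrightarrow> small ((f :: 'u \<Rightarrow> 'u) ` A)"
    and small_Union: "small A \<Longrightarrow> (\<And>x :: 'u. x \<in> A \<Longrightarrow> small (S x)) \<Longrightarrow> small (\<Union>x\<in>A. S x)"
    and small_doubleton: "small {x, y}"

definition small_cat :: "('u :: infinite set \<Rightarrow> bool) \<Rightarrow> ('u, 'u) cat \<Rightarrow> bool" where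
  "small_cat small C \<longleftrightarrow> category C \<and> small (Obj C) \<and> small (Arr C)"

text \<open>As \<open>'u\<close> is infinite, ordered pairs and tagged elements of \<open>'u\<close> can be coded in \<open>'u\<close>.\<close>

definition upair :: "'u :: infinite \<times> 'u \<Rightarrow> 'u" where
  "upair = (SOME f. inj f)"

definition usum :: "'u :: infinite + 'u \<Rightarrow> 'u" where
  "usum = (SOME f. inj f)"

lemma inj_upair: "inj (upair :: 'u :: infinite \<times> 'u \<Rightarrow> 'u)"
proof -
  obtain f where "bij_betw f ((UNIV :: 'u set) \<times> (UNIV :: 'u set)) (UNIV :: 'u set)"
    using card_of_ordIso[THEN iffD2, OF card_of_Times_same_infinite[OF infinite_UNIV]] by blast
  then have "inj (f :: 'u \<times> 'u \<Rightarrow> 'u)"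
    by (simp add: bij_betw_def)
  then show ?thesis
    unfolding upair_def by (rule someI[of inj])
qed

lemma inj_usum: "inj (usum :: 'u :: infinite + 'u \<Rightarrow> 'u)"
proof -
  obtain a b :: 'u where ab: "a \<noteq> b"
    using infinite_UNIV by (metis finite.emptyI finite.insertI UNIV_I finite_subset insertCI subsetI singletonI)
  have "inj (\<lambda>x :: 'u + 'u. upair (case x of Inl y \<Rightarrow> (a, y) | Inr y \<Rightarrow> (b, y)))"
    using ab by (auto simp: inj_on_def inj_eq[OF inj_upair] split: sum.splits)
  then show ?thesis
    unfolding usum_def by (rule someI[of inj])
qed

definition ufst :: "'u :: infinite \<Rightarrow> 'u" where
  "ufst x = fst (inv upair x)"

definition usnd :: "'u :: infinite \<Rightarrow> 'u" where
  "usnd x = snd (inv upair x)"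

definition empty_cat :: "('u, 'u) cat" where
  "empty_cat = mk_cat {} {} (\<lambda>_. undefined) (\<lambda>_. undefined) (\<lambda>_. undefined) (\<lambda>_ _. undefined)"

text \<open>The terminal category \<open>e\<close>.\<close>

definition star :: 'u where
  "star = (SOME x. True)"

definition pt_cat :: "('u, 'u) cat" where
  "pt_cat = mk_cat {star} {star} (\<lambda>_. star) (\<lambda>_. star) (\<lambda>_. star) (\<lambda>_ _. star)"

definition to_pt :: "('u, 'u) cat \<Rightarrow> ('u, 'u, 'u, 'u) func" where
  "to_pt C = mk_func C pt_cat (\<lambda>_. star) (\<lambda>_. star)"

definition point :: "('u, 'u) cat \<Rightarrow> 'u \<Rightarrow> ('u, 'u, 'u, 'u) func" where
  "point K k = mk_func pt_cat K (\<lambda>_. k) (\<lambda>_. Ident K k)"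

definition sum_cat :: "('u :: infinite, 'u) cat \<Rightarrow> ('u, 'u) cat \<Rightarrow> ('u, 'u) cat" where
  "sum_cat A B = mk_cat (usum ` (Obj A <+> Obj B)) (usum ` (Arr A <+> Arr B))
    (\<lambda>f. usum (map_sum (Dom A) (Dom B) (inv usum f)))
    (\<lambda>f. usum (map_sum (Cod A) (Cod B) (inv usum f)))
    (\<lambda>x. usum (map_sum (Ident A) (Ident B) (inv usum x)))
    (\<lambda>g f. case (inv usum g, inv usum f) of
        (Inl g', Inl f') \<Rightarrow> usum (Inl (g' \<cdot>\<^bsub>A\<^esub> f'))
      | (Inr g', Inr f') \<Rightarrow> usum (Inr (g' \<cdot>\<^bsub>B\<^esub> f'))
      | _ \<Rightarrow> undefined)"

definition sum_inl :: "('u :: infinite, 'u) cat \<Rightarrow> ('u, 'u) cat \<Rightarrow> ('u, 'u, 'u, 'u) func" where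
  "sum_inl A B = mk_func A (sum_cat A B) (usum \<circ> Inl) (usum \<circ> Inl)"

definition sum_inr :: "('u :: infinite, 'u) cat \<Rightarrow> ('u, 'u) cat \<Rightarrow> ('u, 'u, 'u, 'u) func" where
  "sum_inr A B = mk_func B (sum_cat A B) (usum \<circ> Inr) (usum \<circ> Inr)"

text \<open>
  The categories \<open>J\<^bsub>/k\<^esub>\<close> and \<open>J\<^bsub>k/\<^esub>\<close>.  An object \<open>(j, f)\<close> is coded as \<open>upair (j, f)\<close>.  An arrow
  from \<open>x\<close> to \<open>y\<close> given by \<open>h\<close> in \<open>J\<close> is coded as \<open>upair (upair (x, y), h)\<close>; recording source
  and target makes the hom-sets disjoint.
\<close>

definition over_obj :: "('u :: infinite, 'u, 'u, 'u) func \<Rightarrow> 'u \<Rightarrow> 'u set" where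
  "over_obj u k = {upair (j, f) | j f. j \<in> Obj (Src u) \<and> f \<in> Hom (Tgt u) (OMap u j) k}"

definition over_arr :: "('u :: infinite, 'u, 'u, 'u) func \<Rightarrow> 'u \<Rightarrow> 'u set" where
  "over_arr u k = {upair (upair (x, y), h) | x y h.
    x \<in> over_obj u k \<and> y \<in> over_obj u k \<and> h \<in> Hom (Src u) (ufst x) (ufst y) \<and>
    usnd y \<cdot>\<^bsub>Tgt u\<^esub> AMap u h = usnd x}"

definition under_obj :: "('u :: infinite, 'u, 'u, 'u) func \<Rightarrow> 'u \<Rightarrow> 'u set" where
  "under_obj u k = {upair (j, f) | j f. j \<in> Obj (Src u) \<and> f \<in> Hom (Tgt u) k (OMap u j)}"

definition under_arr :: "('u :: infinite, 'u, 'u, 'u) func \<Rightarrow> 'u \<Rightarrow> 'u set" where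
  "under_arr u k = {upair (upair (x, y), h) | x y h.
    x \<in> under_obj u k \<and> y \<in> under_obj u k \<and> h \<in> Hom (Src u) (ufst x) (ufst y) \<and>
    AMap u h \<cdot>\<^bsub>Tgt u\<^esub> usnd x = usnd y}"

definition comma_on ::
  "('u :: infinite, 'u) cat \<Rightarrow> 'u set \<Rightarrow> 'u set \<Rightarrow> ('u, 'u) cat" where
  "comma_on J Ob Ar = mk_cat Ob Ar
    (\<lambda>m. ufst (ufst m)) (\<lambda>m. usnd (ufst m))
    (\<lambda>x. upair (upair (x, x), Ident J (ufst x)))
    (\<lambda>n m. upair (upair (ufst (ufst m), usnd (ufst n)), usnd n \<cdot>\<^bsub>J\<^esub> usnd m))"

definition over_cat :: "('u :: infinite, 'u, 'u, 'u) func \<Rightarrow> 'u \<Rightarrow> ('u, 'u) cat" where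
  "over_cat u k = comma_on (Src u) (over_obj u k) (over_arr u k)"

definition under_cat :: "('u :: infinite, 'u, 'u, 'u) func \<Rightarrow> 'u \<Rightarrow> ('u, 'u) cat" where
  "under_cat u k = comma_on (Src u) (under_obj u k) (under_arr u k)"

definition over_pr :: "('u :: infinite, 'u, 'u, 'u) func \<Rightarrow> 'u \<Rightarrow> ('u, 'u, 'u, 'u) func" where
  "over_pr u k = mk_func (over_cat u k) (Src u) ufst usnd"

definition under_pr :: "('u :: infinite, 'u, 'u, 'u) func \<Rightarrow> 'u \<Rightarrow> ('u, 'u, 'u, 'u) func" where
  "under_pr u k = mk_func (under_cat u k) (Src u) ufst usnd"

definition over_nat :: "('u :: infinite, 'u, 'u, 'u) func \<Rightarrow> 'u \<Rightarrow> ('u, 'u, 'u, 'u) nat_tr" where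
  "over_nat u k = mk_nat (u \<circ>\<^sub>F over_pr u k) (point (Tgt u) k \<circ>\<^sub>F to_pt (over_cat u k)) usnd"

definition under_nat :: "('u :: infinite, 'u, 'u, 'u) func \<Rightarrow> 'u \<Rightarrow> ('u, 'u, 'u, 'u) nat_tr" where
  "under_nat u k = mk_nat (point (Tgt u) k \<circ>\<^sub>F to_pt (under_cat u k)) (u \<circ>\<^sub>F under_pr u k) usnd"

section \<open>Derivators\<close>

text \<open>
  The categories \<open>\<D>(K)\<close> have objects and arrows in arbitrary types \<open>'o\<close> and \<open>'m\<close> and need not be
  small.  The values of the three maps outside small categories, functors between them and
  transformations between these are irrelevant.
\<close>

record ('u, 'o, 'm) prederiv =
  on_cat :: "('u, 'u) cat \<Rightarrow> ('o, 'm) cat"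
  on_func :: "('u, 'u, 'u, 'u) func \<Rightarrow> ('o, 'm, 'o, 'm) func"
  on_nat :: "('u, 'u, 'u, 'u) nat_tr \<Rightarrow> ('o, 'm, 'o, 'm) nat_tr"

locale prederivator = universe small
  for small :: "'u :: infinite set \<Rightarrow> bool" +
  fixes D :: "('u, 'o, 'm) prederiv"
  assumes on_cat: "small_cat small J \<Longrightarrow> category (on_cat D J)"
    and on_func: "small_cat small J \<Longrightarrow> small_cat small K \<Longrightarrow> is_functor u J K \<Longrightarrow>
      is_functor (on_func D u) (on_cat D K) (on_cat D J)"
    and on_nat: "small_cat small J \<Longrightarrow> small_cat small K \<Longrightarrow> is_nat \<alpha> u v J K \<Longrightarrow>
      is_nat (on_nat D \<alpha>) (on_func D u) (on_func D v) (on_cat D K) (on_cat D J)"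
    and on_func_id: "small_cat small J \<Longrightarrow> on_func D (id_func J) = id_func (on_cat D J)"
    and on_func_comp: "small_cat small J \<Longrightarrow> small_cat small K \<Longrightarrow> small_cat small L \<Longrightarrow>
      is_functor u J K \<Longrightarrow> is_functor v K L \<Longrightarrow>
      on_func D (v \<circ>\<^sub>F u) = on_func D u \<circ>\<^sub>F on_func D v"
    and on_nat_id: "small_cat small J \<Longrightarrow> small_cat small K \<Longrightarrow> is_functor u J K \<Longrightarrow>
      on_nat D (id_nat u) = id_nat (on_func D u)"
    and on_nat_vcomp: "small_cat small J \<Longrightarrow> small_cat small K \<Longrightarrow>
      is_nat \<alpha> u v J K \<Longrightarrow> is_nat \<beta> v w J K \<Longrightarrow>
      on_nat D (\<beta> \<bullet>\<^sub>v \<alpha>) = on_nat D \<beta> \<bullet>\<^sub>v on_nat D \<alpha>"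
    and on_nat_hcomp: "small_cat small J \<Longrightarrow> small_cat small K \<Longrightarrow> small_cat small L \<Longrightarrow>
      is_nat \<alpha> u u' J K \<Longrightarrow> is_nat \<beta> v v' K L \<Longrightarrow>
      on_nat D (\<beta> \<star> \<alpha>) = on_nat D \<alpha> \<star> on_nat D \<beta>"

text \<open>
  \<open>left_kan D J K u L \<eta> \<epsilon>\<close>: the functor \<open>L\<close> is a choice of \<open>u\<^sub>!\<close>, with unit \<open>\<eta>\<close> and counit \<open>\<epsilon>\<close> of the
  adjunction with \<open>u\<^sup>*\<close>; dually \<open>right_kan D J K u R \<eta> \<epsilon>\<close> for \<open>u\<^sub>*\<close>.
\<close>

definition left_kan ::
  "('u, 'o, 'm) prederiv \<Rightarrow> ('u, 'u) cat \<Rightarrow> ('u, 'u) cat \<Rightarrow> ('u, 'u, 'u, 'u) func \<Rightarrow>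
   ('o, 'm, 'o, 'm) func \<Rightarrow> ('o, 'm, 'o, 'm) nat_tr \<Rightarrow> ('o, 'm, 'o, 'm) nat_tr \<Rightarrow> bool" where
  "left_kan D J K u L \<eta> \<epsilon> \<longleftrightarrow> adjunction (on_cat D J) (on_cat D K) L (on_func D u) \<eta> \<epsilon>"

definition right_kan ::
  "('u, 'o, 'm) prederiv \<Rightarrow> ('u, 'u) cat \<Rightarrow> ('u, 'u) cat \<Rightarrow> ('u, 'u, 'u, 'u) func \<Rightarrow>
   ('o, 'm, 'o, 'm) func \<Rightarrow> ('o, 'm, 'o, 'm) nat_tr \<Rightarrow> ('o, 'm, 'o, 'm) nat_tr \<Rightarrow> bool" where
  "right_kan D J K u R \<eta> \<epsilon> \<longleftrightarrow> adjunction (on_cat D K) (on_cat D J) (on_func D u) R \<eta> \<epsilon>"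

text \<open>\<open>value_at D K k\<close> is the functor \<open>k\<^sup>*\<close>, so that \<open>X\<^sub>k\<close> is \<open>OMap (value_at D K k) X\<close>.\<close>

definition value_at ::
  "('u, 'o, 'm) prederiv \<Rightarrow> ('u, 'u) cat \<Rightarrow> 'u \<Rightarrow> ('o, 'm, 'o, 'm) func" where
  "value_at D K k = on_func D (point K k)"

text \<open>
  The base change maps \<open>p\<^sub>! pr\<^sup>* \<rightarrow> p\<^sub>! pr\<^sup>* u\<^sup>* u\<^sub>! \<rightarrow> p\<^sub>! p\<^sup>* k\<^sup>* u\<^sub>! \<rightarrow> k\<^sup>* u\<^sub>!\<close> and
  \<open>k\<^sup>* u\<^sub>* \<rightarrow> p\<^sub>* p\<^sup>* k\<^sup>* u\<^sub>* \<rightarrow> p\<^sub>* pr\<^sup>* u\<^sup>* u\<^sub>* \<rightarrow> p\<^sub>* pr\<^sup>*\<close>.  Here \<open>Lu\<close>, \<open>\<eta>u\<close> are \<open>u\<^sub>!\<close> with its unit, \<open>Lp\<close>, \<open>\<epsilon>p\<close>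
  are \<open>p\<^sub>!\<close> with its counit; \<open>Ru\<close>, \<open>\<epsilon>u\<close> are \<open>u\<^sub>*\<close> with its counit, \<open>Rp\<close>, \<open>\<eta>p\<close> are \<open>p\<^sub>*\<close> with its
  unit.
\<close>

definition left_base_change where
  "left_base_change D u k Lu \<eta>u Lp \<epsilon>p =
    (\<epsilon>p \<star> id_nat (value_at D (Tgt u) k \<circ>\<^sub>F Lu)) \<bullet>\<^sub>v
    (id_nat Lp \<star> on_nat D (over_nat u k) \<star> id_nat Lu) \<bullet>\<^sub>v
    (id_nat (Lp \<circ>\<^sub>F on_func D (over_pr u k)) \<star> \<eta>u)"

definition right_base_change where
  "right_base_change D u k Ru \<epsilon>u Rp \<eta>p =
    (id_nat (Rp \<circ>\<^sub>F on_func D (under_pr u k)) \<star> \<epsilon>u) \<bullet>\<^sub>v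
    (id_nat Rp \<star> on_nat D (under_nat u k) \<star> id_nat Ru) \<bullet>\<^sub>v
    (\<eta>p \<star> id_nat (value_at D (Tgt u) k \<circ>\<^sub>F Ru))"

text \<open>
  \<open>u\<^sub>!\<close> and \<open>u\<^sub>*\<close> are only determined up to unique isomorphism.  \<open>Der4\<close> is stated for every choice of the
  adjunctions; whether the base change maps are isomorphisms does not depend on the choice.
\<close>

locale derivator = prederivator +
  assumes Der1_sum: "small_cat small J1 \<Longrightarrow> small_cat small J2 \<Longrightarrow>
      is_equivalence (pair_func (on_func D (sum_inl J1 J2)) (on_func D (sum_inr J1 J2)))
        (on_cat D (sum_cat J1 J2)) (prod_cat (on_cat D J1) (on_cat D J2))"
    and Der1_empty: "Obj (on_cat D empty_cat) \<noteq> {}"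
    and Der2: "small_cat small J \<Longrightarrow> f \<in> Arr (on_cat D J) \<Longrightarrow>
      is_iso (on_cat D J) f \<longleftrightarrow> (\<forall>j\<in>Obj J. is_iso (on_cat D pt_cat) (AMap (value_at D J j) f))"
    and Der3_left: "small_cat small J \<Longrightarrow> small_cat small K \<Longrightarrow> is_functor u J K \<Longrightarrow>
      \<exists>L \<eta> \<epsilon>. left_kan D J K u L \<eta> \<epsilon>"
    and Der3_right: "small_cat small J \<Longrightarrow> small_cat small K \<Longrightarrow> is_functor u J K \<Longrightarrow>
      \<exists>R \<eta> \<epsilon>. right_kan D J K u R \<eta> \<epsilon>"
    and Der4_left: "small_cat small J \<Longrightarrow> small_cat small K \<Longrightarrow> is_functor u J K \<Longrightarrow> k \<in> Obj K \<Longrightarrow>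
      left_kan D J K u Lu \<eta>u \<epsilon>u \<Longrightarrow>
      left_kan D (over_cat u k) pt_cat (to_pt (over_cat u k)) Lp \<eta>p \<epsilon>p \<Longrightarrow>
      is_nat_iso (left_base_change D u k Lu \<eta>u Lp \<epsilon>p)
        (Lp \<circ>\<^sub>F on_func D (over_pr u k)) (value_at D K k \<circ>\<^sub>F Lu)
        (on_cat D J) (on_cat D pt_cat)"
    and Der4_right: "small_cat small J \<Longrightarrow> small_cat small K \<Longrightarrow> is_functor u J K \<Longrightarrow> k \<in> Obj K \<Longrightarrow>
      right_kan D J K u Ru \<eta>u \<epsilon>u \<Longrightarrow>
      right_kan D (under_cat u k) pt_cat (to_pt (under_cat u k)) Rp \<eta>p \<epsilon>p \<Longrightarrow>
      is_nat_iso (right_base_change D u k Ru \<epsilon>u Rp \<eta>p)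
        (value_at D K k \<circ>\<^sub>F Ru) (Rp \<circ>\<^sub>F on_func D (under_pr u k))
        (on_cat D J) (on_cat D pt_cat)"

locale pointed_derivator = derivator +
  assumes pointed: "\<exists>z. zero_object (on_cat D pt_cat) z"

end

theory Submission
  imports Defs
begin

text \<open>
  Let \<open>u : J \<rightarrow> K\<close> be a cosieve.  The value of \<open>u\<^sub>! X\<close> at \<open>k\<close> is computed by \<open>Der4\<close> as the colimit of
  \<open>pr\<^sup>* X\<close> over \<open>J\<^bsub>/k\<^esub>\<close>, and only two extreme kinds of comma categories occur.

  \<^item> If \<open>k = u(j)\<close>, then \<open>(j, id)\<close> is terminal in \<open>J\<^bsub>/k\<^esub>\<close> because \<open>u\<close> is fully faithful, so the colimit
    is just \<open>X\<^sub>j\<close>.  More precisely, evaluation at the terminal object is left adjoint to \<open>p\<^sup>*\<close>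
    (\<open>left_kan_terminal\<close>), and for this choice of \<open>p\<^sub>!\<close> the base change map is the value at \<open>j\<close> of the
    unit \<open>X \<rightarrow> u\<^sup>* u\<^sub>! X\<close> (\<open>left_base_change_at_image\<close>).  By \<open>Der2\<close> the unit is invertible, which
    means that \<open>u\<^sub>!\<close> is fully faithful.

  \<^item> If \<open>k\<close> is not in the image, then \<open>J\<^bsub>/k\<^esub>\<close> is empty because \<open>u\<close> is a cosieve.  All objects of
    \<open>\<D>(\<emptyset>)\<close> are initial (\<open>empty_Hom\<close>), and \<open>p\<^sub>!\<close> preserves initial objects, so \<open>(u\<^sub>! X)\<^sub>k\<close> is initial
    in \<open>\<D>(e)\<close>, that is, zero (\<open>left_kan_vanishes\<close>).

  Hence objects in the essential image of \<open>u\<^sub>!\<close> vanish outside the image of \<open>u\<close>.  Conversely, for \<open>X\<close>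
  vanishing there, the counit \<open>u\<^sub>! u\<^sup>* X \<rightarrow> X\<close> is invertible by \<open>Der2\<close>: at \<open>k\<close> outside the image it
  is an arrow between zero objects, and at \<open>u(j)\<close> it is a value of its restriction along \<open>u\<close>, which is
  inverse to the unit at \<open>u\<^sup>* X\<close> by a triangle identity (\<open>left_essential_image\<close>).

  The second half is dual.  The facts about a single adjunction are dualised by passing to opposite
  categories.  The facts about comma categories are instead treated side by side: the codings of
  \<open>J\<^bsub>/k\<^esub>\<close> and \<open>J\<^bsub>k/\<^esub>\<close> record sources and targets of arrows, so they are exchanged by passing to
  opposites only up to isomorphism.
\<close>

section \<open>Categories, functors and transformations\<close>

context category
begin

lemma Hom_Dom: "f \<in> Hom C a b \<Longrightarrow> a \<in> Obj C"
  using Dom_Obj by (auto simp: Hom_def)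

lemma Hom_Cod: "f \<in> Hom C a b \<Longrightarrow> b \<in> Obj C"
  using Cod_Obj by (auto simp: Hom_def)

lemma Arr_Hom: "f \<in> Arr C \<Longrightarrow> f \<in> Hom C (Dom C f) (Cod C f)"
  by (simp add: Hom_def)

lemma Hom_Arr: "f \<in> Hom C a b \<Longrightarrow> f \<in> Arr C"
  by (simp add: Hom_def)

lemma is_iso_I:
  "f \<in> Hom C a b \<Longrightarrow> g \<in> Hom C b a \<Longrightarrow> g \<cdot> f = Ident C a \<Longrightarrow> f \<cdot> g = Ident C b \<Longrightarrow> is_iso C f"
  unfolding is_iso_def by (meson Hom_Cod Hom_Dom)

lemma is_iso_E:
  assumes "is_iso C f" "f \<in> Hom C a b"
  obtains g where "g \<in> Hom C b a" "g \<cdot> f = Ident C a" "f \<cdot> g = Ident C b"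
  using assms unfolding is_iso_def Hom_def by auto

lemma is_iso_Comp:
  assumes f: "f \<in> Hom C a b" "is_iso C f" and g: "g \<in> Hom C b c" "is_iso C g"
  shows "is_iso C (g \<cdot> f)"
proof -
  obtain f' where f': "f' \<in> Hom C b a" "f' \<cdot> f = Ident C a" "f \<cdot> f' = Ident C b"
    using is_iso_E[OF f(2,1)] .
  obtain g' where g': "g' \<in> Hom C c b" "g' \<cdot> g = Ident C b" "g \<cdot> g' = Ident C c"
    using is_iso_E[OF g(2,1)] .
  have "(f' \<cdot> g') \<cdot> (g \<cdot> f) = f' \<cdot> ((g' \<cdot> g) \<cdot> f)"
    using Comp_assoc[OF Comp_Hom[OF f(1) g(1)] g'(1) f'(1)] Comp_assoc[OF f(1) g(1) g'(1)] by simp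
  also have "\<dots> = Ident C a"
    using Comp_Ident_left[OF f(1)] f'(2) g'(2) by simp
  finally have 1: "(f' \<cdot> g') \<cdot> (g \<cdot> f) = Ident C a" .
  have "(g \<cdot> f) \<cdot> (f' \<cdot> g') = g \<cdot> ((f \<cdot> f') \<cdot> g')"
    using Comp_assoc[OF Comp_Hom[OF g'(1) f'(1)] f(1) g(1)] Comp_assoc[OF g'(1) f'(1) f(1)] by simp
  also have "\<dots> = Ident C c"
    using Comp_Ident_left[OF g'(1)] f'(3) g'(3) by simp
  finally have "(g \<cdot> f) \<cdot> (f' \<cdot> g') = Ident C c" .
  with 1 show ?thesis
    by (rule is_iso_I[OF Comp_Hom[OF f(1) g(1)] Comp_Hom[OF g'(1) f'(1)]])
qed

lemma is_iso_left_inverse: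
  assumes f: "f \<in> Hom C a b" "is_iso C f" and g: "g \<in> Hom C b a" "g \<cdot> f = Ident C a"
  shows "is_iso C g"
proof -
  obtain f' where f': "f' \<in> Hom C b a" "f' \<cdot> f = Ident C a" "f \<cdot> f' = Ident C b"
    using is_iso_E[OF f(2,1)] .
  have "g = g \<cdot> (f \<cdot> f')"
    using Comp_Ident_right[OF g(1)] f'(3) by simp
  also have "\<dots> = f'"
    using Comp_assoc[OF f'(1) f(1) g(1)] Comp_Ident_left[OF f'(1)] g(2) by simp
  finally show ?thesis
    using is_iso_I[OF f'(1) f(1) f'(3,2)] by simp
qed

lemma isomorphic_E:
  assumes "isomorphic C a b"
  obtains f g where "f \<in> Hom C a b" "g \<in> Hom C b a" "g \<cdot> f = Ident C a" "f \<cdot> g = Ident C b"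
proof -
  obtain f where f: "f \<in> Hom C a b" "is_iso C f"
    using assms unfolding isomorphic_def by auto
  from f(2,1) show ?thesis
    by (rule is_iso_E) (rule that[OF f(1)])
qed

lemma isomorphic_I:
  "f \<in> Hom C a b \<Longrightarrow> g \<in> Hom C b a \<Longrightarrow> g \<cdot> f = Ident C a \<Longrightarrow> f \<cdot> g = Ident C b \<Longrightarrow>
    isomorphic C a b"
  unfolding isomorphic_def using is_iso_I by metis

lemma isomorphic_sym: "isomorphic C a b \<Longrightarrow> isomorphic C b a"
  by (erule isomorphic_E) (rule isomorphic_I)

lemma isomorphic_trans:
  assumes "isomorphic C a b" "isomorphic C b c"
  shows "isomorphic C a c"
proof -
  obtain f g where "f \<in> Hom C a b" "is_iso C f" "g \<in> Hom C b c" "is_iso C g"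
    using assms unfolding isomorphic_def by auto
  then show ?thesis
    unfolding isomorphic_def using is_iso_Comp[of f a b g c] Comp_Hom[of f a b g c] by auto
qed

lemma isomorphic_initial:
  assumes a: "a \<in> Obj C" "\<And>x. x \<in> Obj C \<Longrightarrow> \<exists>!f. f \<in> Hom C a x"
    and b: "b \<in> Obj C" "\<And>x. x \<in> Obj C \<Longrightarrow> \<exists>!f. f \<in> Hom C b x"
  shows "isomorphic C a b"
proof -
  obtain f g where f: "f \<in> Hom C a b" and g: "g \<in> Hom C b a"
    using a(2)[OF b(1)] b(2)[OF a(1)] by auto
  have "g \<cdot> f = Ident C a"
    using a(2)[OF a(1)] Comp_Hom[OF f g] Ident_Hom[OF a(1)] by auto
  moreover have "f \<cdot> g = Ident C b"
    using b(2)[OF b(1)] Comp_Hom[OF g f] Ident_Hom[OF b(1)] by auto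
  ultimately show ?thesis
    using isomorphic_I[OF f g] by simp
qed

lemma Hom_isomorphic_zero_unique:
  assumes z: "zero_object C z" and "isomorphic C a z" and f: "f \<in> Hom C a b" "f' \<in> Hom C a b"
  shows "f = f'"
proof -
  obtain h h' where h: "h \<in> Hom C a z" "h' \<in> Hom C z a" "h' \<cdot> h = Ident C a"
    using isomorphic_E[OF assms(2)] by metis
  have "f \<cdot> h' = f' \<cdot> h'"
    using z Comp_Hom[OF h(2) f(1)] Comp_Hom[OF h(2) f(2)] Hom_Cod[OF f(1)]
    unfolding zero_object_def by blast
  then have "(f \<cdot> h') \<cdot> h = (f' \<cdot> h') \<cdot> h"
    by simp
  then show ?thesis
    using Comp_assoc[OF h(1,2) f(1)] Comp_assoc[OF h(1,2) f(2)] h(3)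
      Comp_Ident_right[OF f(1)] Comp_Ident_right[OF f(2)] by simp
qed

text \<open>Any arrow in the opposite direction is an inverse, because parallel arrows between zero objects
  are equal.\<close>

lemma is_iso_between_zeros:
  assumes z: "zero_object C z" and a: "isomorphic C a z" and b: "isomorphic C b z"
    and f: "f \<in> Hom C a b"
  shows "is_iso C f"
proof -
  obtain g where g: "g \<in> Hom C b a"
    using isomorphic_trans[OF b isomorphic_sym[OF a]] unfolding isomorphic_def by blast
  show ?thesis
    using Hom_isomorphic_zero_unique[OF z a Comp_Hom[OF f g] Ident_Hom[OF Hom_Dom[OF f]]]
      Hom_isomorphic_zero_unique[OF z b Comp_Hom[OF g f] Ident_Hom[OF Hom_Cod[OF f]]]
    by (rule is_iso_I[OF f g])
qed

end

lemma
  assumes "is_functor F A B"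
  shows functor_Src: "Src F = A" and functor_Tgt: "Tgt F = B"
    and functor_cat_Src: "category A" and functor_cat_Tgt: "category B"
    and functor_Ident: "a \<in> Obj A \<Longrightarrow> AMap F (Ident A a) = Ident B (OMap F a)"
    and functor_Obj: "a \<in> Obj A \<Longrightarrow> OMap F a \<in> Obj B"
    and functor_OMap_ext: "OMap F \<in> extensional (Obj A)"
    and functor_AMap_ext: "AMap F \<in> extensional (Arr A)"
  using assms by (auto simp: is_functor_def PiE_def)

lemma functor_Hom:
  "is_functor F A B \<Longrightarrow> f \<in> Hom A a b \<Longrightarrow> AMap F f \<in> Hom B (OMap F a) (OMap F b)"
  unfolding is_functor_def using category.Hom_Dom category.Hom_Cod by metis

lemma functor_Comp:
  "is_functor F A B \<Longrightarrow> f \<in> Hom A a b \<Longrightarrow> g \<in> Hom A b c \<Longrightarrow>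
    AMap F (g \<cdot>\<^bsub>A\<^esub> f) = AMap F g \<cdot>\<^bsub>B\<^esub> AMap F f"
  unfolding is_functor_def using category.Hom_Dom category.Hom_Cod by metis

lemma functor_Arr: "is_functor F A B \<Longrightarrow> f \<in> Arr A \<Longrightarrow> AMap F f \<in> Arr B"
  using functor_Hom functor_cat_Src category.Arr_Hom by (fastforce simp: Hom_def)

lemma functor_eqI:
  assumes "is_functor F A B" "is_functor G A B"
    and "\<And>a. a \<in> Obj A \<Longrightarrow> OMap F a = OMap G a" "\<And>f. f \<in> Arr A \<Longrightarrow> AMap F f = AMap G f"
  shows "F = G"
proof -
  have "OMap F = OMap G" "AMap F = AMap G"
    using assms by (auto intro!: extensionalityI functor_OMap_ext functor_AMap_ext)
  then show ?thesis
    using assms(1,2) by (intro func.equality) (auto simp: functor_Src functor_Tgt)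
qed

lemma functor_mk_funcI:
  assumes A: "category A" and B: "category B"
    and 1: "\<And>a. a \<in> Obj A \<Longrightarrow> F a \<in> Obj B"
    and 2: "\<And>a b f. f \<in> Hom A a b \<Longrightarrow> G f \<in> Hom B (F a) (F b)"
    and 3: "\<And>a. a \<in> Obj A \<Longrightarrow> G (Ident A a) = Ident B (F a)"
    and 4: "\<And>a b c f g. f \<in> Hom A a b \<Longrightarrow> g \<in> Hom A b c \<Longrightarrow> G (g \<cdot>\<^bsub>A\<^esub> f) = G g \<cdot>\<^bsub>B\<^esub> G f"
  shows "is_functor (mk_func A B F G) A B"
proof -
  interpret A: category A by fact
  have [simp]: "f \<in> Hom A a b \<Longrightarrow> f \<in> Arr A" for f a b
    by (rule A.Hom_Arr)
  have [simp]: "a \<in> Obj A \<Longrightarrow> Ident A a \<in> Arr A" for a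
    using A.Ident_Hom A.Hom_Arr by blast
  have [simp]: "f \<in> Hom A a b \<Longrightarrow> g \<in> Hom A b c \<Longrightarrow> g \<cdot>\<^bsub>A\<^esub> f \<in> Arr A" for f g a b c
    using A.Comp_Hom A.Hom_Arr by blast
  show ?thesis
    unfolding is_functor_def using assms by (auto simp: mk_func_def)
qed

lemma functor_id: "category A \<Longrightarrow> is_functor (id_func A) A A"
  unfolding id_func_def by (rule functor_mk_funcI) (auto simp: category.Ident_Hom)

lemma functor_comp:
  assumes F: "is_functor F A B" and G: "is_functor G B C"
  shows "is_functor (G \<circ>\<^sub>F F) A C"
  unfolding comp_func_def functor_Src[OF F] functor_Tgt[OF G]
proof (rule functor_mk_funcI[OF functor_cat_Src[OF F] functor_cat_Tgt[OF G]])
  show "(AMap G \<circ> AMap F) (g \<cdot>\<^bsub>A\<^esub> f) = (AMap G \<circ> AMap F) g \<cdot>\<^bsub>C\<^esub> (AMap G \<circ> AMap F) f"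
    if "f \<in> Hom A a b" "g \<in> Hom A b c" for a b c f g
    using functor_Comp[OF F that] functor_Comp[OF G functor_Hom[OF F that(1)] functor_Hom[OF F that(2)]]
    by simp
qed (simp_all add: functor_Ident[OF F] functor_Ident[OF G] functor_Obj[OF F] functor_Obj[OF G]
    functor_Hom[OF G] functor_Hom[OF F])

lemma comp_OMap: "is_functor F A B \<Longrightarrow> a \<in> Obj A \<Longrightarrow> OMap (G \<circ>\<^sub>F F) a = OMap G (OMap F a)"
  and comp_AMap: "is_functor F A B \<Longrightarrow> f \<in> Arr A \<Longrightarrow> AMap (G \<circ>\<^sub>F F) f = AMap G (AMap F f)"
  by (simp_all add: comp_func_def mk_func_def functor_Src)

lemma id_OMap: "a \<in> Obj A \<Longrightarrow> OMap (id_func A) a = a"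
  and id_AMap: "f \<in> Arr A \<Longrightarrow> AMap (id_func A) f = f"
  by (simp_all add: id_func_def mk_func_def)

lemma comp_id_right: "is_functor F A B \<Longrightarrow> F \<circ>\<^sub>F id_func A = F"
  by (rule functor_eqI[of _ A B])
    (auto intro: functor_comp functor_id functor_cat_Src
      simp: comp_OMap[OF functor_id] comp_AMap[OF functor_id] functor_cat_Src id_OMap id_AMap)

lemma comp_id_left: "is_functor F A B \<Longrightarrow> id_func B \<circ>\<^sub>F F = F"
  by (rule functor_eqI[of _ A B])
    (auto intro: functor_comp functor_id functor_cat_Tgt
      simp: comp_OMap comp_AMap id_OMap id_AMap functor_Obj functor_Arr)

lemma comp_func_assoc:
  assumes "is_functor F A B" "is_functor G B C" "is_functor H C E"
  shows "(H \<circ>\<^sub>F G) \<circ>\<^sub>F F = H \<circ>\<^sub>F (G \<circ>\<^sub>F F)"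
  by (rule functor_eqI[of _ A E])
    (use assms in \<open>auto intro!: functor_comp simp: comp_OMap[OF assms(1)] comp_AMap[OF assms(1)]
      comp_OMap[OF assms(2)] comp_AMap[OF assms(2)] comp_OMap[OF functor_comp[OF assms(1,2)]]
      comp_AMap[OF functor_comp[OF assms(1,2)]] functor_Obj functor_Arr\<close>)

lemma functor_is_iso:
  assumes F: "is_functor F A B" and f: "is_iso A f"
  shows "is_iso B (AMap F f)"
proof -
  interpret B: category B
    by (rule functor_cat_Tgt[OF F])
  obtain a b g where "a \<in> Obj A" "b \<in> Obj A" "f \<in> Hom A a b" "g \<in> Hom A b a"
      "g \<cdot>\<^bsub>A\<^esub> f = Ident A a" "f \<cdot>\<^bsub>A\<^esub> g = Ident A b"
    using f unfolding is_iso_def by auto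
  then show ?thesis
    by (intro B.is_iso_I[of _ "OMap F a" "OMap F b" "AMap F g"])
      (auto simp: functor_Hom[OF F] functor_Comp[OF F, symmetric] functor_Ident[OF F])
qed

lemma functor_isomorphic:
  "is_functor F A B \<Longrightarrow> isomorphic A a b \<Longrightarrow> isomorphic B (OMap F a) (OMap F b)"
  unfolding isomorphic_def using functor_Hom functor_is_iso by metis

lemma
  assumes "is_nat \<tau> F G A B"
  shows nat_functor_Src: "is_functor F A B" and nat_functor_Tgt: "is_functor G A B"
    and nat_NSrc: "NSrc \<tau> = F" and nat_NTgt: "NTgt \<tau> = G"
    and nat_ext: "Cmp \<tau> \<in> extensional (Obj A)"
    and nat_Hom: "a \<in> Obj A \<Longrightarrow> Cmp \<tau> a \<in> Hom B (OMap F a) (OMap G a)"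
  using assms by (auto simp: is_nat_def)

lemma nat_natural:
  "is_nat \<tau> F G A B \<Longrightarrow> f \<in> Hom A a b \<Longrightarrow>
    Cmp \<tau> b \<cdot>\<^bsub>B\<^esub> AMap F f = AMap G f \<cdot>\<^bsub>B\<^esub> Cmp \<tau> a"
  unfolding is_nat_def is_functor_def using category.Hom_Dom category.Hom_Cod by metis

lemma nat_eqI:
  assumes "is_nat \<sigma> F G A B" "is_nat \<tau> F G A B" "\<And>a. a \<in> Obj A \<Longrightarrow> Cmp \<sigma> a = Cmp \<tau> a"
  shows "\<sigma> = \<tau>"
proof -
  have "Cmp \<sigma> = Cmp \<tau>"
    using assms by (auto intro!: extensionalityI nat_ext)
  then show ?thesis
    using assms(1,2) by (intro nat_tr.equality) (auto simp: nat_NSrc nat_NTgt)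
qed

lemma nat_mk_natI:
  assumes F: "is_functor F A B" and G: "is_functor G A B"
    and t: "\<And>a. a \<in> Obj A \<Longrightarrow> t a \<in> Hom B (OMap F a) (OMap G a)"
    and nat: "\<And>a b f. f \<in> Hom A a b \<Longrightarrow> t b \<cdot>\<^bsub>B\<^esub> AMap F f = AMap G f \<cdot>\<^bsub>B\<^esub> t a"
  shows "is_nat (mk_nat F G t) F G A B"
  unfolding is_nat_def using assms by (auto simp: mk_nat_def functor_Src)

lemma mk_nat_Cmp: "is_functor F A B \<Longrightarrow> a \<in> Obj A \<Longrightarrow> Cmp (mk_nat F G t) a = t a"
  by (simp add: mk_nat_def functor_Src)

lemma nat_id: 
  assumes F: "is_functor F A B" shows "is_nat (id_nat F) F F A B"
proof -
  interpret B: category B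
    by (rule functor_cat_Tgt[OF F])
  show ?thesis
    unfolding id_nat_def functor_Tgt[OF F]
    by (rule nat_mk_natI[OF F F])
      (auto simp: B.Ident_Hom functor_Obj[OF F]
        B.Comp_Ident_left[OF functor_Hom[OF F]] B.Comp_Ident_right[OF functor_Hom[OF F]])
qed

lemma id_nat_Cmp: "is_functor F A B \<Longrightarrow> a \<in> Obj A \<Longrightarrow> Cmp (id_nat F) a = Ident B (OMap F a)"
  by (simp add: id_nat_def mk_nat_Cmp functor_Tgt)

lemma vcomp_Cmp:
  "NSrc \<sigma> = F \<Longrightarrow> is_functor F A B \<Longrightarrow> a \<in> Obj A \<Longrightarrow> Cmp (\<tau> \<bullet>\<^sub>v \<sigma>) a = Cmp \<tau> a \<cdot>\<^bsub>B\<^esub> Cmp \<sigma> a"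
  by (simp add: vcomp_def mk_nat_def functor_Src functor_Tgt)

lemma vcomp_NSrc: "NSrc (\<tau> \<bullet>\<^sub>v \<sigma>) = NSrc \<sigma>"
  by (simp add: vcomp_def mk_nat_def)

lemma whisker_left_Cmp:
  assumes \<sigma>: "is_nat \<sigma> G H A B" and F: "is_functor F B C" and a: "a \<in> Obj A"
  shows "Cmp (id_nat F \<star> \<sigma>) a = AMap F (Cmp \<sigma> a)"
proof -
  interpret C: category C
    by (rule functor_cat_Tgt[OF F])
  have "Cmp (id_nat F \<star> \<sigma>) a = Cmp (id_nat F) (OMap H a) \<cdot>\<^bsub>C\<^esub> AMap F (Cmp \<sigma> a)"
    using a by (simp add: hcomp_def nat_NSrc[OF nat_id[OF F]] nat_NSrc[OF \<sigma>] nat_NTgt[OF \<sigma>]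
      mk_nat_Cmp[OF functor_comp[OF nat_functor_Src[OF \<sigma>] F]] functor_Tgt[OF F])
  also have "\<dots> = AMap F (Cmp \<sigma> a)"
    using id_nat_Cmp[OF F] functor_Obj[OF nat_functor_Tgt[OF \<sigma>]] a
      C.Comp_Ident_left[OF functor_Hom[OF F nat_Hom[OF \<sigma> a]]] by simp
  finally show ?thesis .
qed

lemma whisker_right_Cmp:
  assumes \<tau>: "is_nat \<tau> G H B C" and F: "is_functor F A B" and a: "a \<in> Obj A"
  shows "Cmp (\<tau> \<star> id_nat F) a = Cmp \<tau> (OMap F a)"
proof -
  interpret C: category C
    by (rule functor_cat_Tgt[OF nat_functor_Src[OF \<tau>]])
  have Fa: "OMap F a \<in> Obj B"
    using functor_Obj[OF F a] .
  have "Cmp (\<tau> \<star> id_nat F) a = Cmp \<tau> (OMap F a) \<cdot>\<^bsub>C\<^esub> AMap G (Cmp (id_nat F) a)"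
    using a by (simp add: hcomp_def nat_NSrc[OF nat_id[OF F]] nat_NTgt[OF nat_id[OF F]]
      nat_NSrc[OF \<tau>] mk_nat_Cmp[OF functor_comp[OF F nat_functor_Src[OF \<tau>]]]
      functor_Tgt[OF nat_functor_Src[OF \<tau>]])
  also have "\<dots> = Cmp \<tau> (OMap F a)"
    using id_nat_Cmp[OF F a] functor_Ident[OF nat_functor_Src[OF \<tau>] Fa]
      C.Comp_Ident_right[OF nat_Hom[OF \<tau> Fa]] by simp
  finally show ?thesis .
qed

lemma nat_whisker_left:
  assumes \<sigma>: "is_nat \<sigma> G H A B" and F: "is_functor F B C"
  shows "is_nat (id_nat F \<star> \<sigma>) (F \<circ>\<^sub>F G) (F \<circ>\<^sub>F H) A C"
proof -
  interpret A: category A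
    by (rule functor_cat_Src[OF nat_functor_Src[OF \<sigma>]])
  note G = nat_functor_Src[OF \<sigma>] and H = nat_functor_Tgt[OF \<sigma>]
  note FG = functor_comp[OF G F] and FH = functor_comp[OF H F]
  have "is_nat (mk_nat (F \<circ>\<^sub>F G) (F \<circ>\<^sub>F H) (Cmp (id_nat F \<star> \<sigma>))) (F \<circ>\<^sub>F G) (F \<circ>\<^sub>F H) A C"
  proof (rule nat_mk_natI[OF FG FH])
    show "Cmp (id_nat F \<star> \<sigma>) a \<in> Hom C (OMap (F \<circ>\<^sub>F G) a) (OMap (F \<circ>\<^sub>F H) a)" if "a \<in> Obj A" for a
      using functor_Hom[OF F nat_Hom[OF \<sigma> that]] that
      by (simp add: whisker_left_Cmp[OF \<sigma> F] comp_OMap[OF G] comp_OMap[OF H])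
  next
    fix a b f assume f: "f \<in> Hom A a b"
    have ab: "a \<in> Obj A" "b \<in> Obj A"
      using f A.Hom_Dom A.Hom_Cod by blast+
    show "Cmp (id_nat F \<star> \<sigma>) b \<cdot>\<^bsub>C\<^esub> AMap (F \<circ>\<^sub>F G) f = AMap (F \<circ>\<^sub>F H) f \<cdot>\<^bsub>C\<^esub> Cmp (id_nat F \<star> \<sigma>) a"
      using functor_Comp[OF F functor_Hom[OF G f] nat_Hom[OF \<sigma> ab(2)]]
        functor_Comp[OF F nat_Hom[OF \<sigma> ab(1)] functor_Hom[OF H f]] nat_natural[OF \<sigma> f] ab
      by (simp add: whisker_left_Cmp[OF \<sigma> F] comp_AMap[OF G A.Hom_Arr[OF f]]
          comp_AMap[OF H A.Hom_Arr[OF f]])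
  qed
  moreover have "mk_nat (F \<circ>\<^sub>F G) (F \<circ>\<^sub>F H) (Cmp (id_nat F \<star> \<sigma>)) = id_nat F \<star> \<sigma>"
    by (simp add: hcomp_def mk_nat_def nat_NSrc[OF nat_id[OF F]] nat_NTgt[OF nat_id[OF F]]
      nat_NSrc[OF \<sigma>] nat_NTgt[OF \<sigma>])
  ultimately show ?thesis
    by simp
qed

lemma nat_whisker_right:
  assumes \<tau>: "is_nat \<tau> G H B C" and F: "is_functor F A B"
  shows "is_nat (\<tau> \<star> id_nat F) (G \<circ>\<^sub>F F) (H \<circ>\<^sub>F F) A C"
proof -
  interpret A: category A
    by (rule functor_cat_Src[OF F])
  note G = nat_functor_Src[OF \<tau>] and H = nat_functor_Tgt[OF \<tau>]
  have "is_nat (mk_nat (G \<circ>\<^sub>F F) (H \<circ>\<^sub>F F) (Cmp (\<tau> \<star> id_nat F))) (G \<circ>\<^sub>F F) (H \<circ>\<^sub>F F) A C"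
    by (rule nat_mk_natI[OF functor_comp[OF F G] functor_comp[OF F H]])
      (auto simp: whisker_right_Cmp[OF \<tau> F] comp_OMap[OF F] comp_AMap[OF F] nat_Hom[OF \<tau>]
        functor_Obj[OF F] A.Hom_Dom A.Hom_Cod A.Hom_Arr nat_natural[OF \<tau> functor_Hom[OF F]])
  moreover have "mk_nat (G \<circ>\<^sub>F F) (H \<circ>\<^sub>F F) (Cmp (\<tau> \<star> id_nat F)) = \<tau> \<star> id_nat F"
    by (simp add: hcomp_def mk_nat_def nat_NSrc[OF nat_id[OF F]] nat_NTgt[OF nat_id[OF F]]
      nat_NSrc[OF \<tau>] nat_NTgt[OF \<tau>])
  ultimately show ?thesis
    by simp
qed

section \<open>Adjunctions with invertible unit\<close>

locale adjoint =
  fixes A :: "('a, 'b) cat" and B :: "('c, 'd) cat"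
    and L :: "('a, 'b, 'c, 'd) func" and R :: "('c, 'd, 'a, 'b) func"
    and \<eta> :: "('a, 'b, 'a, 'b) nat_tr" and \<epsilon> :: "('c, 'd, 'c, 'd) nat_tr"
  assumes adjunction: "adjunction A B L R \<eta> \<epsilon>"
begin

lemma left: "is_functor L A B" and right: "is_functor R B A"
  and unit: "is_nat \<eta> (id_func A) (R \<circ>\<^sub>F L) A A" and counit: "is_nat \<epsilon> (L \<circ>\<^sub>F R) (id_func B) B B"
  and triangle_left: "a \<in> Obj A \<Longrightarrow> Cmp \<epsilon> (OMap L a) \<cdot>\<^bsub>B\<^esub> AMap L (Cmp \<eta> a) = Ident B (OMap L a)"
  and triangle_right: "b \<in> Obj B \<Longrightarrow> AMap R (Cmp \<epsilon> b) \<cdot>\<^bsub>A\<^esub> Cmp \<eta> (OMap R b) = Ident A (OMap R b)"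
  using adjunction by (auto simp: adjunction_def)

sublocale A: category A
  by (rule functor_cat_Src[OF left])

sublocale B: category B
  by (rule functor_cat_Tgt[OF left])

lemma unit_Hom: "a \<in> Obj A \<Longrightarrow> Cmp \<eta> a \<in> Hom A a (OMap R (OMap L a))"
  using nat_Hom[OF unit] by (simp add: id_OMap comp_OMap[OF left])

lemma counit_Hom: "b \<in> Obj B \<Longrightarrow> Cmp \<epsilon> b \<in> Hom B (OMap L (OMap R b)) b"
  using nat_Hom[OF counit] by (simp add: id_OMap comp_OMap[OF right])

lemma unit_natural:
  "f \<in> Hom A a a' \<Longrightarrow> Cmp \<eta> a' \<cdot>\<^bsub>A\<^esub> f = AMap R (AMap L f) \<cdot>\<^bsub>A\<^esub> Cmp \<eta> a"
  using nat_natural[OF unit] by (simp add: id_AMap comp_AMap[OF left] A.Hom_Arr)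

lemma counit_natural:
  "g \<in> Hom B b b' \<Longrightarrow> Cmp \<epsilon> b' \<cdot>\<^bsub>B\<^esub> AMap L (AMap R g) = g \<cdot>\<^bsub>B\<^esub> Cmp \<epsilon> b"
  using nat_natural[OF counit] by (simp add: id_AMap comp_AMap[OF right] B.Hom_Arr)

lemma transpose_inverse:
  assumes a: "a \<in> Obj A" and g: "g \<in> Hom B (OMap L a) b"
  shows "Cmp \<epsilon> b \<cdot>\<^bsub>B\<^esub> AMap L (AMap R g \<cdot>\<^bsub>A\<^esub> Cmp \<eta> a) = g"
proof -
  have b: "b \<in> Obj B" and La: "OMap L a \<in> Obj B"
    using g B.Hom_Cod B.Hom_Dom by auto
  note Rg = functor_Hom[OF right g]
  note LRg = functor_Hom[OF left Rg] and L\<eta> = functor_Hom[OF left unit_Hom[OF a]]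
  have "Cmp \<epsilon> b \<cdot>\<^bsub>B\<^esub> AMap L (AMap R g \<cdot>\<^bsub>A\<^esub> Cmp \<eta> a)
      = (Cmp \<epsilon> b \<cdot>\<^bsub>B\<^esub> AMap L (AMap R g)) \<cdot>\<^bsub>B\<^esub> AMap L (Cmp \<eta> a)"
    using functor_Comp[OF left unit_Hom[OF a] Rg] B.Comp_assoc[OF L\<eta> LRg counit_Hom[OF b]] by simp
  also have "\<dots> = g \<cdot>\<^bsub>B\<^esub> (Cmp \<epsilon> (OMap L a) \<cdot>\<^bsub>B\<^esub> AMap L (Cmp \<eta> a))"
    using counit_natural[OF g] B.Comp_assoc[OF L\<eta> counit_Hom[OF La] g] by simp
  also have "\<dots> = g"
    using triangle_left[OF a] B.Comp_Ident_right[OF g] by simp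
  finally show ?thesis .
qed

lemma left_preserves_initial:
  assumes a: "a \<in> Obj A" and initial: "\<And>x. x \<in> Obj A \<Longrightarrow> \<exists>!f. f \<in> Hom A a x"
    and b: "b \<in> Obj B"
  shows "\<exists>!g. g \<in> Hom B (OMap L a) b"
proof -
  obtain f where f: "f \<in> Hom A a (OMap R b)"
    using initial functor_Obj[OF right b] by blast
  have "g = Cmp \<epsilon> b \<cdot>\<^bsub>B\<^esub> AMap L f" if g: "g \<in> Hom B (OMap L a) b" for g
  proof -
    have "AMap R g \<cdot>\<^bsub>A\<^esub> Cmp \<eta> a = f"
      using initial functor_Obj[OF right b] f A.Comp_Hom[OF unit_Hom[OF a] functor_Hom[OF right g]]
      by blast
    then show ?thesis
      using transpose_inverse[OF a g] by simp
  qed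
  moreover have "Cmp \<epsilon> b \<cdot>\<^bsub>B\<^esub> AMap L f \<in> Hom B (OMap L a) b"
    using B.Comp_Hom[OF functor_Hom[OF left f] counit_Hom[OF b]] .
  ultimately show ?thesis
    by blast
qed

text \<open>If the unit is invertible, then \<open>L\<close> sends its inverse to the counit by the first triangle
  identity.  Hence composing with the inverse of the unit turns the transpose of \<open>g : L a \<rightarrow> L a'\<close>
  into a preimage of \<open>g\<close> under \<open>L\<close>.\<close>

lemma left_fully_faithful:
  assumes iso: "\<And>a. a \<in> Obj A \<Longrightarrow> is_iso A (Cmp \<eta> a)"
  shows "fully_faithful L"
  unfolding fully_faithful_def functor_Src[OF left] functor_Tgt[OF left]
proof (intro ballI)
  fix a a' assume a: "a \<in> Obj A" and a': "a' \<in> Obj A"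
  note La' = functor_Obj[OF left a']
  obtain i where i: "i \<in> Hom A (OMap R (OMap L a')) a'" "i \<cdot>\<^bsub>A\<^esub> Cmp \<eta> a' = Ident A a'"
      "Cmp \<eta> a' \<cdot>\<^bsub>A\<^esub> i = Ident A (OMap R (OMap L a'))"
    using A.is_iso_E[OF iso[OF a'] unit_Hom[OF a']] .
  note L\<eta> = functor_Hom[OF left unit_Hom[OF a']] and Li = functor_Hom[OF left i(1)]
  have "AMap L i = (Cmp \<epsilon> (OMap L a') \<cdot>\<^bsub>B\<^esub> AMap L (Cmp \<eta> a')) \<cdot>\<^bsub>B\<^esub> AMap L i"
    using triangle_left[OF a'] B.Comp_Ident_left[OF Li] by simp
  also have "\<dots> = Cmp \<epsilon> (OMap L a') \<cdot>\<^bsub>B\<^esub> AMap L (Cmp \<eta> a' \<cdot>\<^bsub>A\<^esub> i)"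
    using B.Comp_assoc[OF Li L\<eta> counit_Hom[OF La']] functor_Comp[OF left i(1) unit_Hom[OF a']]
    by simp
  also have "\<dots> = Cmp \<epsilon> (OMap L a')"
    using i(3) functor_Ident[OF left functor_Obj[OF right La']]
      B.Comp_Ident_right[OF counit_Hom[OF La']] by simp
  finally have Li_eq: "AMap L i = Cmp \<epsilon> (OMap L a')" .
  show "bij_betw (AMap L) (Hom A a a') (Hom B (OMap L a) (OMap L a'))"
  proof (rule bij_betw_byWitness[where f' = "\<lambda>g. i \<cdot>\<^bsub>A\<^esub> (AMap R g \<cdot>\<^bsub>A\<^esub> Cmp \<eta> a)"])
    show "\<forall>f\<in>Hom A a a'. i \<cdot>\<^bsub>A\<^esub> (AMap R (AMap L f) \<cdot>\<^bsub>A\<^esub> Cmp \<eta> a) = f"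
    proof
      fix f assume f: "f \<in> Hom A a a'"
      show "i \<cdot>\<^bsub>A\<^esub> (AMap R (AMap L f) \<cdot>\<^bsub>A\<^esub> Cmp \<eta> a) = f"
        using unit_natural[OF f] A.Comp_assoc[OF f unit_Hom[OF a'] i(1)] i(2) A.Comp_Ident_left[OF f]
        by simp
    qed
    show "\<forall>g\<in>Hom B (OMap L a) (OMap L a'). AMap L (i \<cdot>\<^bsub>A\<^esub> (AMap R g \<cdot>\<^bsub>A\<^esub> Cmp \<eta> a)) = g"
    proof
      fix g assume g: "g \<in> Hom B (OMap L a) (OMap L a')"
      show "AMap L (i \<cdot>\<^bsub>A\<^esub> (AMap R g \<cdot>\<^bsub>A\<^esub> Cmp \<eta> a)) = g"
        using functor_Comp[OF left A.Comp_Hom[OF unit_Hom[OF a] functor_Hom[OF right g]] i(1)]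
          Li_eq transpose_inverse[OF a g] by simp
    qed
    show "AMap L ` Hom A a a' \<subseteq> Hom B (OMap L a) (OMap L a')"
      using functor_Hom[OF left] by blast
    show "(\<lambda>g. i \<cdot>\<^bsub>A\<^esub> (AMap R g \<cdot>\<^bsub>A\<^esub> Cmp \<eta> a)) ` Hom B (OMap L a) (OMap L a') \<subseteq> Hom A a a'"
      using A.Comp_Hom[OF A.Comp_Hom[OF unit_Hom[OF a] functor_Hom[OF right]] i(1)] by blast
  qed
qed

text \<open>The pattern of the theorem for one adjunction.  The functors \<open>W k\<close> play the role of evaluation
  at the objects \<open>k\<close> of \<open>I\<close> and \<open>S\<close> that of the image of the cosieve.  The point is that the counit
  at \<open>b\<close> can only fail to be invertible at the objects outside \<open>S\<close>, because \<open>R\<close> makes it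
  invertible; there its source vanishes, so it is invertible iff its target vanishes as well.\<close>

lemma left_essential_image:
  assumes iso: "\<And>a. a \<in> Obj A \<Longrightarrow> is_iso A (Cmp \<eta> a)"
    and W: "\<And>k. k \<in> I \<Longrightarrow> is_functor (W k) B E"
    and conservative: "\<And>f. f \<in> Arr B \<Longrightarrow> (\<And>k. k \<in> I \<Longrightarrow> is_iso E (AMap (W k) f)) \<Longrightarrow> is_iso B f"
    and S: "\<And>k f. k \<in> S \<Longrightarrow> f \<in> Arr B \<Longrightarrow> is_iso A (AMap R f) \<Longrightarrow> is_iso E (AMap (W k) f)"
    and z: "zero_object E z"
    and vanish: "\<And>k a. k \<in> I - S \<Longrightarrow> a \<in> Obj A \<Longrightarrow> isomorphic E (OMap (W k) (OMap L a)) z"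
    and b: "b \<in> Obj B"
  shows "b \<in> essential_image L \<longleftrightarrow> (\<forall>k\<in>I - S. isomorphic E (OMap (W k) b) z)"
proof
  assume "b \<in> essential_image L"
  then obtain a where a: "a \<in> Obj A" "isomorphic B (OMap L a) b"
    unfolding essential_image_def functor_Src[OF left] functor_Tgt[OF left] by blast
  show "\<forall>k\<in>I - S. isomorphic E (OMap (W k) b) z"
  proof
    fix k assume k: "k \<in> I - S"
    then have Wk: "is_functor (W k) B E"
      using W by simp
    interpret E: category E
      by (rule functor_cat_Tgt[OF Wk])
    show "isomorphic E (OMap (W k) b) z"
      using E.isomorphic_trans[OF E.isomorphic_sym[OF functor_isomorphic[OF Wk a(2)]] vanish[OF k a(1)]] .
  qed
next
  assume zero: "\<forall>k\<in>I - S. isomorphic E (OMap (W k) b) z"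
  note Rb = functor_Obj[OF right b]
  note \<epsilon>b = counit_Hom[OF b]
  have R\<epsilon>: "is_iso A (AMap R (Cmp \<epsilon> b))"
    using A.is_iso_left_inverse[OF unit_Hom[OF Rb] iso[OF Rb] functor_Hom[OF right \<epsilon>b]
        triangle_right[OF b]] .
  have "is_iso B (Cmp \<epsilon> b)"
  proof (rule conservative[OF B.Hom_Arr[OF \<epsilon>b]])
    fix k assume k: "k \<in> I"
    show "is_iso E (AMap (W k) (Cmp \<epsilon> b))"
    proof (cases "k \<in> S")
      case True
      then show ?thesis
        using S[OF True B.Hom_Arr[OF \<epsilon>b] R\<epsilon>] by simp
    next
      case False
      interpret E: category E
        by (rule functor_cat_Tgt[OF W[OF k]])
      show ?thesis
        using E.is_iso_between_zeros[OF z vanish[OF _ Rb] _ functor_Hom[OF W[OF k] \<epsilon>b]] k False zero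
        by simp
    qed
  qed
  then have "isomorphic B (OMap L (OMap R b)) b"
    unfolding isomorphic_def using \<epsilon>b by blast
  then show "b \<in> essential_image L"
    unfolding essential_image_def functor_Src[OF left] functor_Tgt[OF left] using b Rb by blast
qed

end

section \<open>Opposite categories\<close>

definition op_cat :: "('o, 'm) cat \<Rightarrow> ('o, 'm) cat" where
  "op_cat C = \<lparr> Obj = Obj C, Arr = Arr C, Dom = Cod C, Cod = Dom C, Ident = Ident C,
    Comp = (\<lambda>g f. f \<cdot>\<^bsub>C\<^esub> g) \<rparr>"

definition op_func :: "('a, 'b, 'c, 'd) func \<Rightarrow> ('a, 'b, 'c, 'd) func" where
  "op_func F = \<lparr> Src = op_cat (Src F), Tgt = op_cat (Tgt F), OMap = OMap F, AMap = AMap F \<rparr>"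

definition op_nat :: "('a, 'b, 'c, 'd) nat_tr \<Rightarrow> ('a, 'b, 'c, 'd) nat_tr" where
  "op_nat \<tau> = \<lparr> NSrc = op_func (NTgt \<tau>), NTgt = op_func (NSrc \<tau>), Cmp = Cmp \<tau> \<rparr>"

lemma op_cat_simps [simp]:
  "Obj (op_cat C) = Obj C" "Arr (op_cat C) = Arr C" "Ident (op_cat C) = Ident C"
  "Dom (op_cat C) = Cod C" "Cod (op_cat C) = Dom C" "g \<cdot>\<^bsub>op_cat C\<^esub> f = f \<cdot>\<^bsub>C\<^esub> g"
  "Hom (op_cat C) a b = Hom C b a"
  by (auto simp: op_cat_def Hom_def)

lemma op_func_simps [simp]:
  "OMap (op_func F) = OMap F" "AMap (op_func F) = AMap F"
  "Src (op_func F) = op_cat (Src F)" "Tgt (op_func F) = op_cat (Tgt F)"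
  by (simp_all add: op_func_def)

lemma category_op: "category C \<Longrightarrow> category (op_cat C)"
  unfolding category_def by (simp add: Hom_def) metis

lemma functor_op: "is_functor F A B \<Longrightarrow> is_functor (op_func F) (op_cat A) (op_cat B)"
  unfolding is_functor_def by (auto simp: category_op)

lemma op_func_id: "op_func (id_func A) = id_func (op_cat A)"
  by (simp add: op_func_def id_func_def mk_func_def)

lemma op_func_comp: "op_func (G \<circ>\<^sub>F F) = op_func G \<circ>\<^sub>F op_func F"
  by (simp add: op_func_def comp_func_def mk_func_def)

lemma nat_op:
  "is_nat \<tau> F G A B \<Longrightarrow> is_nat (op_nat \<tau>) (op_func G) (op_func F) (op_cat A) (op_cat B)"
  unfolding is_nat_def by (auto simp: functor_op op_nat_def)

lemma adjunction_op:
  "adjunction A B L R \<eta> \<epsilon> \<Longrightarrow>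
    adjunction (op_cat B) (op_cat A) (op_func R) (op_func L) (op_nat \<epsilon>) (op_nat \<eta>)"
  unfolding adjunction_def
  by (auto simp: functor_op op_func_id[symmetric] op_func_comp[symmetric] intro!: nat_op)
    (auto simp: op_nat_def)

lemma is_iso_op: "is_iso (op_cat C) f \<longleftrightarrow> is_iso C f"
  unfolding is_iso_def op_cat_simps by blast

lemma isomorphic_op: "isomorphic (op_cat C) a b \<longleftrightarrow> isomorphic C b a"
  by (simp add: isomorphic_def is_iso_op)

lemma zero_object_op: "zero_object (op_cat C) z \<longleftrightarrow> zero_object C z"
  by (auto simp: zero_object_def)

lemma fully_faithful_op: "fully_faithful (op_func F) \<longleftrightarrow> fully_faithful F"
  by (auto simp: fully_faithful_def)

lemma essential_image_op: "category (Tgt F) \<Longrightarrow> essential_image (op_func F) = essential_image F"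
  unfolding essential_image_def by (auto simp: isomorphic_op intro: category.isomorphic_sym)

context adjoint
begin

lemma adjoint_op: "adjoint (op_cat B) (op_cat A) (op_func R) (op_func L) (op_nat \<epsilon>) (op_nat \<eta>)"
  by (rule adjoint.intro[OF adjunction_op[OF adjunction]])

lemma right_preserves_terminal:
  assumes "b \<in> Obj B" "\<And>x. x \<in> Obj B \<Longrightarrow> \<exists>!f. f \<in> Hom B x b" "a \<in> Obj A"
  shows "\<exists>!g. g \<in> Hom A a (OMap R b)"
  using adjoint.left_preserves_initial[OF adjoint_op, of b a] assms by simp

lemma right_fully_faithful:
  assumes "\<And>b. b \<in> Obj B \<Longrightarrow> is_iso B (Cmp \<epsilon> b)"
  shows "fully_faithful R"
  using adjoint.left_fully_faithful[OF adjoint_op] assms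
  by (simp add: is_iso_op fully_faithful_op op_nat_def)

lemma right_essential_image:
  assumes "\<And>b. b \<in> Obj B \<Longrightarrow> is_iso B (Cmp \<epsilon> b)"
    and W: "\<And>k. k \<in> I \<Longrightarrow> is_functor (W k) A E"
    and "\<And>f. f \<in> Arr A \<Longrightarrow> (\<And>k. k \<in> I \<Longrightarrow> is_iso E (AMap (W k) f)) \<Longrightarrow> is_iso A f"
    and "\<And>k f. k \<in> S \<Longrightarrow> f \<in> Arr A \<Longrightarrow> is_iso B (AMap L f) \<Longrightarrow> is_iso E (AMap (W k) f)"
    and "zero_object E z"
    and vanish: "\<And>k b. k \<in> I - S \<Longrightarrow> b \<in> Obj B \<Longrightarrow> isomorphic E (OMap (W k) (OMap R b)) z"
    and a: "a \<in> Obj A"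
  shows "a \<in> essential_image R \<longleftrightarrow> (\<forall>k\<in>I - S. isomorphic E (OMap (W k) a) z)"
proof -
  have sym: "isomorphic E x y \<longleftrightarrow> isomorphic E y x" if "k \<in> I - S" for k x y
    using category.isomorphic_sym[OF functor_cat_Tgt[OF W]] that by blast
  have "a \<in> essential_image (op_func R) \<longleftrightarrow>
      (\<forall>k\<in>I - S. isomorphic (op_cat E) (OMap (op_func (W k)) a) z)"
    by (rule adjoint.left_essential_image[OF adjoint_op])
      (use assms sym in \<open>auto simp: is_iso_op isomorphic_op zero_object_op op_nat_def
        intro: functor_op\<close>)
  then show ?thesis
    using sym by (simp add: essential_image_op functor_Tgt[OF right] A.category_axioms
      isomorphic_op)
qed

end

section \<open>The terminal category and comma categories\<close>

lemma mk_cat_simps [simp]: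
  "Obj (mk_cat Ob Ar d c i m) = Ob" "Arr (mk_cat Ob Ar d c i m) = Ar"
  "f \<in> Ar \<Longrightarrow> Dom (mk_cat Ob Ar d c i m) f = d f" "f \<in> Ar \<Longrightarrow> Cod (mk_cat Ob Ar d c i m) f = c f"
  "x \<in> Ob \<Longrightarrow> Ident (mk_cat Ob Ar d c i m) x = i x"
  "f \<in> Ar \<Longrightarrow> g \<in> Ar \<Longrightarrow> d g = c f \<Longrightarrow> g \<cdot>\<^bsub>mk_cat Ob Ar d c i m\<^esub> f = m g f"
  by (simp_all add: mk_cat_def)

lemma mk_cat_Hom: "Hom (mk_cat Ob Ar d c i m) a b = {f \<in> Ar. d f = a \<and> c f = b}"
  by (auto simp: Hom_def)

lemma category_mk_cat:
  assumes "\<And>f. f \<in> Ar \<Longrightarrow> d f \<in> Ob" "\<And>f. f \<in> Ar \<Longrightarrow> c f \<in> Ob"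
    and "\<And>a. a \<in> Ob \<Longrightarrow> i a \<in> Ar \<and> d (i a) = a \<and> c (i a) = a"
    and "\<And>f g. f \<in> Ar \<Longrightarrow> g \<in> Ar \<Longrightarrow> d g = c f \<Longrightarrow> m g f \<in> Ar \<and> d (m g f) = d f \<and> c (m g f) = c g"
    and "\<And>f. f \<in> Ar \<Longrightarrow> m (i (c f)) f = f" "\<And>f. f \<in> Ar \<Longrightarrow> m f (i (d f)) = f"
    and "\<And>f g h. f \<in> Ar \<Longrightarrow> g \<in> Ar \<Longrightarrow> h \<in> Ar \<Longrightarrow> d g = c f \<Longrightarrow> d h = c g \<Longrightarrow>
      m h (m g f) = m (m h g) f"
  shows "category (mk_cat Ob Ar d c i m)"
  by unfold_locales (use assms in \<open>auto simp: mk_cat_Hom\<close>, auto simp: mk_cat_def)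

lemma pt_cat_simps [simp]:
  "Obj pt_cat = {star}" "Arr pt_cat = {star}" "Ident pt_cat star = star" "star \<cdot>\<^bsub>pt_cat\<^esub> star = star"
  by (simp_all add: pt_cat_def)

lemma pt_cat_Hom: "f \<in> Hom pt_cat a b \<longleftrightarrow> f = star \<and> a = star \<and> b = star"
  by (auto simp: pt_cat_def mk_cat_Hom)

lemma category_pt: "category pt_cat"
  unfolding pt_cat_def by (rule category_mk_cat) auto

lemma functor_to_pt: "category C \<Longrightarrow> is_functor (to_pt C) C pt_cat"
  unfolding to_pt_def by (rule functor_mk_funcI) (auto simp: category_pt pt_cat_Hom)

lemma functor_point:
  assumes "category K" "k \<in> Obj K" shows "is_functor (point K k) pt_cat K"
  unfolding point_def using category.Ident_Hom[OF assms] category.Comp_Ident_left[OF assms(1)]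
  by (intro functor_mk_funcI) (use assms in \<open>auto simp: category_pt pt_cat_Hom\<close>)

lemma point_simps [simp]: "OMap (point K k) star = k" "AMap (point K k) star = Ident K k"
  by (simp_all add: point_def mk_func_def)

lemma to_pt_simps [simp]:
  "c \<in> Obj C \<Longrightarrow> OMap (to_pt C) c = star" "f \<in> Arr C \<Longrightarrow> AMap (to_pt C) f = star"
  by (simp_all add: to_pt_def mk_func_def)

lemma functor_comp_point:
  assumes u: "is_functor u J K" and j: "j \<in> Obj J"
  shows "u \<circ>\<^sub>F point J j = point K (OMap u j)"
proof -
  note point = functor_point[OF functor_cat_Src[OF u] j]
  show ?thesis
    by (rule functor_eqI[OF functor_comp[OF point u] functor_point[OF functor_cat_Tgt[OF u]]])
      (auto simp: comp_OMap[OF point] comp_AMap[OF point] functor_Ident[OF u j] functor_Obj[OF u j])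
qed

lemma to_pt_comp_point:
  assumes C: "category C" and c: "c \<in> Obj C"
  shows "to_pt C \<circ>\<^sub>F point C c = id_func pt_cat"
proof -
  have "Ident C c \<in> Arr C"
    using category.Ident_Hom[OF C c] by (simp add: Hom_def)
  then show ?thesis
    by (intro functor_eqI[OF functor_comp[OF functor_point[OF C c] functor_to_pt[OF C]]
          functor_id[OF category_pt]])
      (auto simp: comp_OMap[OF functor_point[OF C c]] comp_AMap[OF functor_point[OF C c]]
        id_OMap id_AMap c)
qed

lemma ufst_upair [simp]: "ufst (upair p) = fst p" and usnd_upair [simp]: "usnd (upair p) = snd p"
  by (simp_all add: ufst_def usnd_def inv_f_f[OF inj_upair])

lemma upair_eq_iff [simp]: "upair p = upair q \<longleftrightarrow> p = q"
  by (rule inj_eq[OF inj_upair])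

lemma small_cat_category: "small_cat small C \<Longrightarrow> category C"
  by (simp add: small_cat_def)

context universe
begin

lemma small_upair: 
  assumes "small A" "small B" shows "small (upair ` (A \<times> B))"
proof -
  have "upair ` (A \<times> B) = (\<Union>a\<in>A. (\<lambda>b. upair (a, b)) ` B)"
    by auto
  then show ?thesis
    using assms by (simp add: small_Union small_image)
qed

lemma small_cat_pt: "small_cat small pt_cat"
  using small_doubleton[of star star] by (simp add: small_cat_def category_pt)

end

text \<open>The common pattern of \<open>over_cat\<close> and \<open>under_cat\<close>: \<open>P x y h\<close> says that the triangle formed by
  the structure arrows of \<open>x\<close> and \<open>y\<close> and the image of \<open>h\<close> commutes.\<close>

locale comma = J: category J
  for J :: "('u :: infinite, 'u) cat" (structure) +
  fixes Ob :: "'u set" and P :: "'u \<Rightarrow> 'u \<Rightarrow> 'u \<Rightarrow> bool"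
  assumes Ob: "x \<in> Ob \<Longrightarrow> ufst x \<in> Obj J"
    and P_Ident: "x \<in> Ob \<Longrightarrow> P x x (Ident J (ufst x))"
    and P_Comp: "x \<in> Ob \<Longrightarrow> y \<in> Ob \<Longrightarrow> z \<in> Ob \<Longrightarrow> h \<in> Hom J (ufst x) (ufst y) \<Longrightarrow>
      h' \<in> Hom J (ufst y) (ufst z) \<Longrightarrow> P x y h \<Longrightarrow> P y z h' \<Longrightarrow> P x z (h' \<cdot> h)"
begin

definition Ar :: "'u set" where
  "Ar = {upair (upair (x, y), h) | x y h.
    x \<in> Ob \<and> y \<in> Ob \<and> h \<in> Hom J (ufst x) (ufst y) \<and> P x y h}"

lemma Ar_I:
  "x \<in> Ob \<Longrightarrow> y \<in> Ob \<Longrightarrow> h \<in> Hom J (ufst x) (ufst y) \<Longrightarrow> P x y h \<Longrightarrow> upair (upair (x, y), h) \<in> Ar"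
  by (auto simp: Ar_def)

lemma Ar_E:
  assumes "f \<in> Ar"
  obtains x y h where "f = upair (upair (x, y), h)" "x \<in> Ob" "y \<in> Ob"
    "h \<in> Hom J (ufst x) (ufst y)" "P x y h"
  using assms by (auto simp: Ar_def)

lemma category_comma: "category (comma_on J Ob Ar)"
  unfolding comma_on_def
proof (rule category_mk_cat, goal_cases)
  case (3 a)
  then show ?case
    by (auto intro!: Ar_I P_Ident J.Ident_Hom Ob)
next
  case (4 f g)
  then obtain x y z h h' where fg: "f = upair (upair (x, y), h)" "g = upair (upair (y, z), h')"
    and obj: "x \<in> Ob" "y \<in> Ob" "z \<in> Ob" and h: "h \<in> Hom J (ufst x) (ufst y)" "P x y h"
    and h': "h' \<in> Hom J (ufst y) (ufst z)" "P y z h'"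
    by (auto elim!: Ar_E)
  then show ?case
    using Ar_I[OF obj(1,3) J.Comp_Hom[OF h(1) h'(1)] P_Comp[OF obj h(1) h'(1) h(2) h'(2)]] by simp
next
  case (7 f g h)
  then show ?case
    by (auto elim!: Ar_E intro!: J.Comp_assoc)
qed (auto elim!: Ar_E simp: J.Comp_Ident_left J.Comp_Ident_right)

lemma comma_Obj: "Obj (comma_on J Ob Ar) = Ob"
  by (simp add: comma_on_def)

lemma comma_Hom:
  "f \<in> Hom (comma_on J Ob Ar) x y \<longleftrightarrow>
    x \<in> Ob \<and> y \<in> Ob \<and> (\<exists>h\<in>Hom J (ufst x) (ufst y). P x y h \<and> f = upair (upair (x, y), h))"
  by (auto simp: comma_on_def mk_cat_Hom elim!: Ar_E intro!: Ar_I)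

lemma functor_pr: "is_functor (mk_func (comma_on J Ob Ar) J ufst usnd) (comma_on J Ob Ar) J"
proof (rule functor_mk_funcI[OF category_comma J.category_axioms], goal_cases)
  case (4 a b c f g)
  then have "f \<in> Ar" "g \<in> Ar" "ufst (ufst g) = usnd (ufst f)"
    by (auto simp: comma_on_def mk_cat_Hom)
  then show ?case
    by (simp add: comma_on_def)
qed (auto simp: comma_Hom comma_Obj Ob, simp add: comma_on_def)

lemma small_cat_comma:
  assumes "universe small" and J: "small_cat small J" and Ob: "small Ob"
  shows "small_cat small (comma_on J Ob Ar)"
proof -
  interpret universe small
    by fact
  have "small (upair ` (upair ` (Ob \<times> Ob) \<times> Arr J))"
    using J Ob by (intro small_upair) (simp_all add: small_cat_def)
  moreover have "Ar \<subseteq> upair ` (upair ` (Ob \<times> Ob) \<times> Arr J)"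
    by (auto elim!: Ar_E simp: Hom_def)
  ultimately show ?thesis
    using Ob category_comma small_subset by (auto simp: small_cat_def comma_Obj) (simp add: comma_on_def)
qed

end

locale functor_at =
  fixes J K :: "('u :: infinite, 'u) cat" and u :: "('u, 'u, 'u, 'u) func" and k :: 'u
  assumes u: "is_functor u J K" and k: "k \<in> Obj K"
begin

sublocale J: category J
  by (rule functor_cat_Src[OF u])

sublocale K: category K
  by (rule functor_cat_Tgt[OF u])

lemma over_obj_iff:
  "x \<in> over_obj u k \<longleftrightarrow> (\<exists>j f. x = upair (j, f) \<and> j \<in> Obj J \<and> f \<in> Hom K (OMap u j) k)"
  by (simp add: over_obj_def functor_Src[OF u] functor_Tgt[OF u])

lemma under_obj_iff:
  "x \<in> under_obj u k \<longleftrightarrow> (\<exists>j f. x = upair (j, f) \<and> j \<in> Obj J \<and> f \<in> Hom K k (OMap u j))"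
  by (simp add: under_obj_def functor_Src[OF u] functor_Tgt[OF u])

sublocale over: comma J "over_obj u k" "\<lambda>x y h. usnd y \<cdot>\<^bsub>K\<^esub> AMap u h = usnd x"
proof (unfold_locales, goal_cases)
  case (2 x)
  then show ?case
    by (auto simp: over_obj_iff functor_Ident[OF u] K.Comp_Ident_right)
next
  case (3 x y z h h')
  then have "usnd z \<in> Hom K (OMap u (ufst z)) k"
    by (auto simp: over_obj_iff)
  then show ?case
    using 3 functor_Comp[OF u 3(4,5)] K.Comp_assoc[OF functor_Hom[OF u 3(4)] functor_Hom[OF u 3(5)]]
    by simp
qed (auto simp: over_obj_iff)

sublocale under: comma J "under_obj u k" "\<lambda>x y h. AMap u h \<cdot>\<^bsub>K\<^esub> usnd x = usnd y"
proof (unfold_locales, goal_cases)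
  case (2 x)
  then show ?case
    by (auto simp: under_obj_iff functor_Ident[OF u] K.Comp_Ident_left)
next
  case (3 x y z h h')
  then have "usnd x \<in> Hom K k (OMap u (ufst x))"
    by (auto simp: under_obj_iff)
  then show ?case
    using 3 functor_Comp[OF u 3(4,5)]
      K.Comp_assoc[OF _ functor_Hom[OF u 3(4)] functor_Hom[OF u 3(5)], of "usnd x" k] by simp
qed (auto simp: under_obj_iff)

lemma over_cat_eq: "over_cat u k = comma_on J (over_obj u k) over.Ar"
  by (simp add: over_cat_def over.Ar_def over_arr_def functor_Src[OF u] functor_Tgt[OF u])

lemma under_cat_eq: "under_cat u k = comma_on J (under_obj u k) under.Ar"
  by (simp add: under_cat_def under.Ar_def under_arr_def functor_Src[OF u] functor_Tgt[OF u])

lemma small_cat_over: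
  assumes "universe small" "small_cat small J" "small_cat small K"
  shows "small_cat small (over_cat u k)"
proof -
  have "over_obj u k \<subseteq> upair ` (Obj J \<times> Arr K)"
    by (auto simp: over_obj_iff Hom_def)
  moreover have "small (upair ` (Obj J \<times> Arr K))"
    using assms(2,3) by (intro universe.small_upair[OF assms(1)]) (simp_all add: small_cat_def)
  ultimately have "small (over_obj u k)"
    using universe.small_subset[OF assms(1)] by blast
  then show ?thesis
    unfolding over_cat_eq using assms by (intro over.small_cat_comma)
qed

lemma small_cat_under:
  assumes "universe small" "small_cat small J" "small_cat small K"
  shows "small_cat small (under_cat u k)"
proof -
  have "under_obj u k \<subseteq> upair ` (Obj J \<times> Arr K)"
    by (auto simp: under_obj_iff Hom_def)
  moreover have "small (upair ` (Obj J \<times> Arr K))"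
    using assms(2,3) by (intro universe.small_upair[OF assms(1)]) (simp_all add: small_cat_def)
  ultimately have "small (under_obj u k)"
    using universe.small_subset[OF assms(1)] by blast
  then show ?thesis
    unfolding under_cat_eq using assms by (intro under.small_cat_comma)
qed

lemma functor_over_pr: "is_functor (over_pr u k) (over_cat u k) J"
  using over.functor_pr by (simp add: over_pr_def over_cat_eq functor_Src[OF u])

lemma functor_under_pr: "is_functor (under_pr u k) (under_cat u k) J"
  using under.functor_pr by (simp add: under_pr_def under_cat_eq functor_Src[OF u])

lemma nat_over:
  "is_nat (over_nat u k) (u \<circ>\<^sub>F over_pr u k) (point K k \<circ>\<^sub>F to_pt (over_cat u k)) (over_cat u k) K"
proof -
  have C: "category (over_cat u k)"
    using over.category_comma by (simp add: over_cat_eq)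
  interpret C: category "over_cat u k"
    by (rule C)
  note p = functor_to_pt[OF C] and k_pt = functor_point[OF K.category_axioms k]
  show ?thesis
    unfolding over_nat_def functor_Tgt[OF u]
  proof (rule nat_mk_natI[OF functor_comp[OF functor_over_pr u] functor_comp[OF p k_pt]], goal_cases)
    case (1 a)
    then have "usnd a \<in> Hom K (OMap u (ufst a)) k" "OMap (over_pr u k) a = ufst a"
      by (auto simp: over_cat_eq over.comma_Obj over_obj_iff over_pr_def mk_func_def)
    then show ?case
      using 1 by (simp add: comp_OMap[OF functor_over_pr] comp_OMap[OF p])
  next
    case (2 a b f)
    then have b: "usnd b \<in> Hom K (OMap u (ufst b)) k" and a: "usnd a \<in> Hom K (OMap u (ufst a)) k"
      and f: "f \<in> Arr (over_cat u k)" "usnd b \<cdot>\<^bsub>K\<^esub> AMap u (usnd f) = usnd a"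
      using C.Hom_Arr by (auto simp: over_cat_eq over.comma_Hom over_obj_iff)
    moreover have "AMap (over_pr u k) f = usnd f"
      using f by (simp add: over_pr_def mk_func_def)
    ultimately show ?case
      using K.Comp_Ident_left[OF a]
      by (simp add: comp_AMap[OF functor_over_pr] comp_AMap[OF p])
  qed
qed

lemma nat_under:
  "is_nat (under_nat u k) (point K k \<circ>\<^sub>F to_pt (under_cat u k)) (u \<circ>\<^sub>F under_pr u k) (under_cat u k) K"
proof -
  have C: "category (under_cat u k)"
    using under.category_comma by (simp add: under_cat_eq)
  interpret C: category "under_cat u k"
    by (rule C)
  note p = functor_to_pt[OF C] and k_pt = functor_point[OF K.category_axioms k]
  show ?thesis
    unfolding under_nat_def functor_Tgt[OF u]
  proof (rule nat_mk_natI[OF functor_comp[OF p k_pt] functor_comp[OF functor_under_pr u]], goal_cases)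
    case (1 a)
    then have "usnd a \<in> Hom K k (OMap u (ufst a))" "OMap (under_pr u k) a = ufst a"
      by (auto simp: under_cat_eq under.comma_Obj under_obj_iff under_pr_def mk_func_def)
    then show ?case
      using 1 by (simp add: comp_OMap[OF functor_under_pr] comp_OMap[OF p])
  next
    case (2 a b f)
    then have b: "usnd b \<in> Hom K k (OMap u (ufst b))" and a: "usnd a \<in> Hom K k (OMap u (ufst a))"
      and f: "f \<in> Arr (under_cat u k)" "AMap u (usnd f) \<cdot>\<^bsub>K\<^esub> usnd a = usnd b"
      using C.Hom_Arr by (auto simp: under_cat_eq under.comma_Hom under_obj_iff)
    moreover have "AMap (under_pr u k) f = usnd f"
      using f by (simp add: under_pr_def mk_func_def)
    ultimately show ?case
      using K.Comp_Ident_right[OF b]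
      by (simp add: comp_AMap[OF functor_under_pr] comp_AMap[OF p])
  qed
qed

text \<open>As \<open>u\<close> is fully faithful, the structure arrow \<open>u(j') \<rightarrow> k = u(j)\<close> of an object of \<open>J\<^bsub>/k\<^esub>\<close> is
  the image of exactly one arrow \<open>j' \<rightarrow> j\<close>, which is the only arrow from that object to \<open>(j, id)\<close>.\<close>

lemma over_terminal:
  assumes ff: "fully_faithful u" and j: "j \<in> Obj J" and kj: "k = OMap u j"
  shows "upair (j, Ident K k) \<in> Obj (over_cat u k)"
    and "x \<in> Obj (over_cat u k) \<Longrightarrow> \<exists>!f. f \<in> Hom (over_cat u k) x (upair (j, Ident K k))"
proof -
  let ?T = "upair (j, Ident K k)"
  have T: "?T \<in> over_obj u k"
    unfolding over_obj_iff using j K.Ident_Hom[OF k] kj by auto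
  then show "?T \<in> Obj (over_cat u k)"
    by (simp add: over_cat_eq over.comma_Obj)
  assume "x \<in> Obj (over_cat u k)"
  then have x: "x \<in> over_obj u k"
    by (simp add: over_cat_eq over.comma_Obj)
  then have fx: "usnd x \<in> Hom K (OMap u (ufst x)) k" and jx: "ufst x \<in> Obj J"
    by (auto simp: over_obj_iff)
  have bij: "bij_betw (AMap u) (Hom J (ufst x) j) (Hom K (OMap u (ufst x)) k)"
    using ff jx j by (simp add: fully_faithful_def functor_Src[OF u] functor_Tgt[OF u] kj)
  then obtain h where h: "h \<in> Hom J (ufst x) j" "AMap u h = usnd x"
    using fx unfolding bij_betw_def by (metis imageE)
  have triangle: "Ident K k \<cdot>\<^bsub>K\<^esub> AMap u h' = AMap u h'" if "h' \<in> Hom J (ufst x) j" for h'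
    using K.Comp_Ident_left functor_Hom[OF u that] by (simp add: kj)
  show "\<exists>!f. f \<in> Hom (over_cat u k) x ?T"
  proof (rule ex1I[of _ "upair (upair (x, ?T), h)"])
    show "upair (upair (x, ?T), h) \<in> Hom (over_cat u k) x ?T"
      using x T h triangle by (simp add: over_cat_eq over.comma_Hom)
    fix f assume "f \<in> Hom (over_cat u k) x ?T"
    then obtain h' where h': "h' \<in> Hom J (ufst x) j" "AMap u h' = usnd x"
        "f = upair (upair (x, ?T), h')"
      using triangle by (auto simp: over_cat_eq over.comma_Hom)
    then show "f = upair (upair (x, ?T), h)"
      using inj_onD[OF bij_betw_imp_inj_on[OF bij], of h' h] h by simp
  qed
qed

lemma under_initial:
  assumes ff: "fully_faithful u" and j: "j \<in> Obj J" and kj: "k = OMap u j"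
  shows "upair (j, Ident K k) \<in> Obj (under_cat u k)"
    and "x \<in> Obj (under_cat u k) \<Longrightarrow> \<exists>!f. f \<in> Hom (under_cat u k) (upair (j, Ident K k)) x"
proof -
  let ?T = "upair (j, Ident K k)"
  have T: "?T \<in> under_obj u k"
    unfolding under_obj_iff using j K.Ident_Hom[OF k] kj by auto
  then show "?T \<in> Obj (under_cat u k)"
    by (simp add: under_cat_eq under.comma_Obj)
  assume "x \<in> Obj (under_cat u k)"
  then have x: "x \<in> under_obj u k"
    by (simp add: under_cat_eq under.comma_Obj)
  then have fx: "usnd x \<in> Hom K k (OMap u (ufst x))" and jx: "ufst x \<in> Obj J"
    by (auto simp: under_obj_iff)
  have bij: "bij_betw (AMap u) (Hom J j (ufst x)) (Hom K k (OMap u (ufst x)))"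
    using ff jx j by (simp add: fully_faithful_def functor_Src[OF u] functor_Tgt[OF u] kj)
  then obtain h where h: "h \<in> Hom J j (ufst x)" "AMap u h = usnd x"
    using fx unfolding bij_betw_def by (metis imageE)
  have triangle: "AMap u h' \<cdot>\<^bsub>K\<^esub> Ident K k = AMap u h'" if "h' \<in> Hom J j (ufst x)" for h'
    using K.Comp_Ident_right functor_Hom[OF u that] by (simp add: kj)
  show "\<exists>!f. f \<in> Hom (under_cat u k) ?T x"
  proof (rule ex1I[of _ "upair (upair (?T, x), h)"])
    show "upair (upair (?T, x), h) \<in> Hom (under_cat u k) ?T x"
      using x T h triangle by (simp add: under_cat_eq under.comma_Hom)
    fix f assume "f \<in> Hom (under_cat u k) ?T x"
    then obtain h' where h': "h' \<in> Hom J j (ufst x)" "AMap u h' = usnd x"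
        "f = upair (upair (?T, x), h')"
      using triangle by (auto simp: under_cat_eq under.comma_Hom)
    then show "f = upair (upair (?T, x), h)"
      using inj_onD[OF bij_betw_imp_inj_on[OF bij], of h' h] h by simp
  qed
qed

end

section \<open>Evaluation and Kan extensions along functors to the terminal category\<close>

context prederivator
begin

lemma functor_value_at:
  "small_cat small K \<Longrightarrow> k \<in> Obj K \<Longrightarrow> is_functor (value_at D K k) (on_cat D K) (on_cat D pt_cat)"
  unfolding value_at_def by (rule on_func[OF small_cat_pt _ functor_point[OF small_cat_category]])

lemma value_at_comp:
  assumes "small_cat small J" "small_cat small K" "is_functor u J K" "j \<in> Obj J"
  shows "value_at D J j \<circ>\<^sub>F on_func D u = value_at D K (OMap u j)"
  using on_func_comp[OF small_cat_pt assms(1,2) functor_point assms(3)] assms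
  by (simp add: value_at_def functor_comp_point small_cat_def)

lemma on_nat_whisker_right:
  assumes "small_cat small H" "small_cat small J" "small_cat small K"
    and \<alpha>: "is_nat \<alpha> u v J K" and t: "is_functor t H J" and X: "X \<in> Obj (on_cat D K)"
  shows "Cmp (on_nat D (\<alpha> \<star> id_nat t)) X = AMap (on_func D t) (Cmp (on_nat D \<alpha>) X)"
  using on_nat_hcomp[OF assms(1-3) nat_id[OF t] \<alpha>] on_nat_id[OF assms(1,2) t]
    whisker_left_Cmp[OF on_nat[OF assms(2,3) \<alpha>] on_func[OF assms(1,2) t] X] by simp

lemma on_nat_whisker_left:
  assumes "small_cat small H" "small_cat small J" "small_cat small K"
    and \<alpha>: "is_nat \<alpha> u v H J" and p: "is_functor p J K" and X: "X \<in> Obj (on_cat D K)"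
  shows "Cmp (on_nat D (id_nat p \<star> \<alpha>)) X = Cmp (on_nat D \<alpha>) (OMap (on_func D p) X)"
  using on_nat_hcomp[OF assms(1-3) \<alpha> nat_id[OF p]] on_nat_id[OF assms(2,3) p]
    whisker_right_Cmp[OF on_nat[OF assms(1,2) \<alpha>] on_func[OF assms(2,3) p] X] by simp

end

text \<open>A category \<open>C\<close> with a distinguished object \<open>c\<close>; the functor \<open>c : e \<rightarrow> C\<close> is a section of
  \<open>C \<rightarrow> e\<close>.\<close>

locale small_cat_at = prederivator small D
  for small :: "'u :: infinite set \<Rightarrow> bool" and D :: "('u, 'o, 'm) prederiv" +
  fixes C :: "('u, 'u) cat" and c :: 'u
  assumes small_C: "small_cat small C" and c: "c \<in> Obj C"
begin

sublocale C: category C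
  using small_C by (simp add: small_cat_def)

abbreviation "p \<equiv> to_pt C"
abbreviation "t \<equiv> point C c"

lemma p: "is_functor p C pt_cat" and t: "is_functor t pt_cat C"
  using functor_to_pt functor_point C.category_axioms c by auto

lemma Dp: "is_functor (on_func D p) (on_cat D pt_cat) (on_cat D C)"
  and Dt: "is_functor (on_func D t) (on_cat D C) (on_cat D pt_cat)"
  using on_func small_C small_cat_pt p t by auto

lemma Dt_Dp: "on_func D t \<circ>\<^sub>F on_func D p = id_func (on_cat D pt_cat)"
  using on_func_comp[OF small_cat_pt small_C small_cat_pt t p] to_pt_comp_point[OF C.category_axioms c]
    on_func_id[OF small_cat_pt] by simp

lemma Dp_Dt: "on_func D p \<circ>\<^sub>F on_func D t = on_func D (t \<circ>\<^sub>F p)"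
  using on_func_comp[OF small_C small_cat_pt small_C p t] by simp

lemma tp_t: "(t \<circ>\<^sub>F p) \<circ>\<^sub>F t = t"
  using c by (simp add: functor_comp_point[OF functor_comp[OF p t]] comp_OMap[OF p])

lemma p_tp: "p \<circ>\<^sub>F (t \<circ>\<^sub>F p) = p"
  using comp_func_assoc[OF p t p] to_pt_comp_point[OF C.category_axioms c] comp_id_left[OF p] by simp

lemma tp_OMap: "x \<in> Obj C \<Longrightarrow> OMap (t \<circ>\<^sub>F p) x = c"
  and tp_AMap: "f \<in> Arr C \<Longrightarrow> AMap (t \<circ>\<^sub>F p) f = Ident C c"
  by (simp_all add: comp_OMap[OF p] comp_AMap[OF p])

text \<open>The two triangle identities of the adjunctions below: a transformation between the identity
  and \<open>t p\<close> that is the identity at \<open>c\<close> becomes trivial after restriction along \<open>t\<close>, and also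
  after composition with \<open>p\<close> because \<open>e\<close> has no other arrows.\<close>

lemma on_nat_at_point:
  assumes \<tau>: "is_nat \<tau> F G C C" and F: "F \<circ>\<^sub>F t = t" and G: "G \<circ>\<^sub>F t = t"
    and \<tau>c: "Cmp \<tau> c = Ident C c" and X: "X \<in> Obj (on_cat D C)"
  shows "AMap (on_func D t) (Cmp (on_nat D \<tau>) X) = Ident (on_cat D pt_cat) (OMap (on_func D t) X)"
proof -
  have "\<tau> \<star> id_nat t = id_nat t"
    by (rule nat_eqI[OF nat_whisker_right[OF \<tau> t, unfolded F G] nat_id[OF t]])
      (simp add: whisker_right_Cmp[OF \<tau> t] \<tau>c id_nat_Cmp[OF t])
  then show ?thesis
    using on_nat_whisker_right[OF small_cat_pt small_C small_C \<tau> t X]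
      on_nat_id[OF small_cat_pt small_C t] id_nat_Cmp[OF Dt X] by simp
qed

lemma on_nat_at_constant:
  assumes \<tau>: "is_nat \<tau> F G C C" and F: "p \<circ>\<^sub>F F = p" and G: "p \<circ>\<^sub>F G = p"
    and Y: "Y \<in> Obj (on_cat D pt_cat)"
  shows "Cmp (on_nat D \<tau>) (OMap (on_func D p) Y) = Ident (on_cat D C) (OMap (on_func D p) Y)"
proof -
  note p\<tau> = nat_whisker_left[OF \<tau> p, unfolded F G]
  have "id_nat p \<star> \<tau> = id_nat p"
    by (rule nat_eqI[OF p\<tau> nat_id[OF p]])
      (use nat_Hom[OF p\<tau>] nat_Hom[OF nat_id[OF p]] in \<open>auto simp: pt_cat_Hom\<close>)
  then show ?thesis
    using on_nat_whisker_left[OF small_C small_C small_cat_pt \<tau> p Y]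
      on_nat_id[OF small_C small_cat_pt p] id_nat_Cmp[OF Dp Y] by simp
qed

text \<open>If \<open>c\<close> is terminal in \<open>C\<close>, then \<open>p\<close> is left adjoint to \<open>t\<close>.  As \<open>D\<close> is a 2-functor, \<open>t\<^sup>*\<close> is
  left adjoint to \<open>p\<^sup>*\<close>, so \<open>t\<^sup>*\<close> is a choice of \<open>p\<^sub>!\<close>, and one with identity counit.\<close>

lemma left_kan_terminal:
  assumes terminal: "\<And>x. x \<in> Obj C \<Longrightarrow> \<exists>!f. f \<in> Hom C x c"
  shows "\<exists>\<eta>. left_kan D C pt_cat p (on_func D t) \<eta> (id_nat (id_func (on_cat D pt_cat)))"
proof -
  let ?E = "on_cat D pt_cat"
  \<comment> \<open>the unit of the adjunction between \<open>p\<close> and \<open>t\<close>\<close>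
  define \<tau> where "\<tau> = mk_nat (id_func C) (t \<circ>\<^sub>F p) (\<lambda>x. THE f. f \<in> Hom C x c)"
  have the: "(THE f. f \<in> Hom C x c) \<in> Hom C x c" if "x \<in> Obj C" for x
    by (rule theI'[OF terminal[OF that]])
  have \<tau>: "is_nat \<tau> (id_func C) (t \<circ>\<^sub>F p) C C"
    unfolding \<tau>_def
  proof (rule nat_mk_natI[OF functor_id[OF C.category_axioms] functor_comp[OF p t]], goal_cases)
    case (1 a)
    then show ?case
      using the by (simp add: id_OMap tp_OMap)
  next
    case (2 a b f)
    have ab: "a \<in> Obj C" "b \<in> Obj C" and f: "f \<in> Arr C"
      using 2 C.Hom_Dom C.Hom_Cod C.Hom_Arr by auto
    have "(THE f. f \<in> Hom C b c) \<cdot>\<^bsub>C\<^esub> f = Ident C c \<cdot>\<^bsub>C\<^esub> (THE f. f \<in> Hom C a c)"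
      using terminal[OF ab(1)] C.Comp_Hom[OF 2 the[OF ab(2)]]
        C.Comp_Hom[OF the[OF ab(1)] C.Ident_Hom[OF c]] by blast
    then show ?case
      by (simp add: id_AMap[OF f] tp_AMap[OF f])
  qed
  have \<tau>c: "Cmp \<tau> c = Ident C c"
    using terminal[OF c] the[OF c] C.Ident_Hom[OF c]
    by (auto simp: \<tau>_def mk_nat_Cmp[OF functor_id[OF C.category_axioms] c])
  have E: "category ?E"
    by (rule functor_cat_Tgt[OF Dt])
  have DC: "category (on_cat D C)"
    by (rule functor_cat_Src[OF Dt])
  note id_E = functor_id[OF E]
  have "left_kan D C pt_cat p (on_func D t) (on_nat D \<tau>) (id_nat (id_func ?E))"
    unfolding left_kan_def adjunction_def
  proof (intro conjI ballI Dt Dp)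
    show "is_nat (on_nat D \<tau>) (id_func (on_cat D C)) (on_func D p \<circ>\<^sub>F on_func D t)
        (on_cat D C) (on_cat D C)"
      using on_nat[OF small_C small_C \<tau>] by (simp add: Dp_Dt on_func_id[OF small_C])
    show "is_nat (id_nat (id_func ?E)) (on_func D t \<circ>\<^sub>F on_func D p) (id_func ?E) ?E ?E"
      using nat_id[OF id_E] by (simp add: Dt_Dp)
  next
    fix X assume X: "X \<in> Obj (on_cat D C)"
    note tX = functor_Obj[OF Dt X]
    show "Cmp (id_nat (id_func ?E)) (OMap (on_func D t) X) \<cdot>\<^bsub>?E\<^esub>
        AMap (on_func D t) (Cmp (on_nat D \<tau>) X) = Ident ?E (OMap (on_func D t) X)"
      using on_nat_at_point[OF \<tau> comp_id_left[OF t] tp_t \<tau>c X] id_nat_Cmp[OF id_E tX] id_OMap[OF tX]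
        category.Comp_Ident_left[OF E category.Ident_Hom[OF E tX]] by simp
  next
    fix Y assume Y: "Y \<in> Obj ?E"
    note pY = functor_Obj[OF Dp Y]
    show "AMap (on_func D p) (Cmp (id_nat (id_func ?E)) Y) \<cdot>\<^bsub>on_cat D C\<^esub>
        Cmp (on_nat D \<tau>) (OMap (on_func D p) Y) = Ident (on_cat D C) (OMap (on_func D p) Y)"
      using on_nat_at_constant[OF \<tau> comp_id_right[OF p] p_tp Y] id_nat_Cmp[OF id_E Y] id_OMap[OF Y]
        functor_Ident[OF Dp Y] category.Comp_Ident_left[OF DC category.Ident_Hom[OF DC pY]] by simp
  qed
  then show ?thesis
    by blast
qed

text \<open>If \<open>c\<close> is initial, then \<open>t\<close> is left adjoint to \<open>p\<close>, and the same functor \<open>t\<^sup>*\<close> is a right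
  adjoint of \<open>p\<^sup>*\<close> with identity unit.\<close>

lemma right_kan_initial:
  assumes initial: "\<And>x. x \<in> Obj C \<Longrightarrow> \<exists>!f. f \<in> Hom C c x"
  shows "\<exists>\<epsilon>. right_kan D C pt_cat p (on_func D t) (id_nat (id_func (on_cat D pt_cat))) \<epsilon>"
proof -
  let ?E = "on_cat D pt_cat"
  \<comment> \<open>the counit of the adjunction between \<open>t\<close> and \<open>p\<close>\<close>
  define \<tau> where "\<tau> = mk_nat (t \<circ>\<^sub>F p) (id_func C) (\<lambda>x. THE f. f \<in> Hom C c x)"
  have the: "(THE f. f \<in> Hom C c x) \<in> Hom C c x" if "x \<in> Obj C" for x
    by (rule theI'[OF initial[OF that]])
  have \<tau>: "is_nat \<tau> (t \<circ>\<^sub>F p) (id_func C) C C"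
    unfolding \<tau>_def
  proof (rule nat_mk_natI[OF functor_comp[OF p t] functor_id[OF C.category_axioms]], goal_cases)
    case (1 a)
    then show ?case
      using the by (simp add: id_OMap tp_OMap)
  next
    case (2 a b f)
    have ab: "a \<in> Obj C" "b \<in> Obj C" and f: "f \<in> Arr C"
      using 2 C.Hom_Dom C.Hom_Cod C.Hom_Arr by auto
    have "(THE f. f \<in> Hom C c b) \<cdot>\<^bsub>C\<^esub> Ident C c = f \<cdot>\<^bsub>C\<^esub> (THE f. f \<in> Hom C c a)"
      using initial[OF ab(2)] C.Comp_Hom[OF the[OF ab(1)] 2]
        C.Comp_Hom[OF C.Ident_Hom[OF c] the[OF ab(2)]] by blast
    then show ?case
      by (simp add: id_AMap[OF f] tp_AMap[OF f])
  qed
  have \<tau>c: "Cmp \<tau> c = Ident C c"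
    using initial[OF c] the[OF c] C.Ident_Hom[OF c]
    by (auto simp: \<tau>_def mk_nat_Cmp[OF functor_comp[OF p t] c])
  have E: "category ?E"
    by (rule functor_cat_Tgt[OF Dt])
  have DC: "category (on_cat D C)"
    by (rule functor_cat_Src[OF Dt])
  note id_E = functor_id[OF E]
  have "right_kan D C pt_cat p (on_func D t) (id_nat (id_func ?E)) (on_nat D \<tau>)"
    unfolding right_kan_def adjunction_def
  proof (intro conjI ballI Dt Dp)
    show "is_nat (on_nat D \<tau>) (on_func D p \<circ>\<^sub>F on_func D t) (id_func (on_cat D C))
        (on_cat D C) (on_cat D C)"
      using on_nat[OF small_C small_C \<tau>] by (simp add: Dp_Dt on_func_id[OF small_C])
    show "is_nat (id_nat (id_func ?E)) (id_func ?E) (on_func D t \<circ>\<^sub>F on_func D p) ?E ?E"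
      using nat_id[OF id_E] by (simp add: Dt_Dp)
  next
    fix X assume X: "X \<in> Obj (on_cat D C)"
    note tX = functor_Obj[OF Dt X]
    show "AMap (on_func D t) (Cmp (on_nat D \<tau>) X) \<cdot>\<^bsub>?E\<^esub>
        Cmp (id_nat (id_func ?E)) (OMap (on_func D t) X) = Ident ?E (OMap (on_func D t) X)"
      using on_nat_at_point[OF \<tau> tp_t comp_id_left[OF t] \<tau>c X] id_nat_Cmp[OF id_E tX] id_OMap[OF tX]
        category.Comp_Ident_left[OF E category.Ident_Hom[OF E tX]] by simp
  next
    fix Y assume Y: "Y \<in> Obj ?E"
    note pY = functor_Obj[OF Dp Y]
    show "Cmp (on_nat D \<tau>) (OMap (on_func D p) Y) \<cdot>\<^bsub>on_cat D C\<^esub>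
        AMap (on_func D p) (Cmp (id_nat (id_func ?E)) Y) = Ident (on_cat D C) (OMap (on_func D p) Y)"
      using on_nat_at_constant[OF \<tau> p_tp comp_id_right[OF p] Y] id_nat_Cmp[OF id_E Y] id_OMap[OF Y]
        functor_Ident[OF Dp Y] category.Comp_Ident_left[OF DC category.Ident_Hom[OF DC pY]] by simp
  qed
  then show ?thesis
    by blast
qed

end

section \<open>Kan extensions along fully faithful functors\<close>

context derivator
begin

text \<open>For \<open>k = u(j)\<close> the category \<open>J\<^bsub>/k\<^esub>\<close> has the terminal object \<open>t = (j, id)\<close>.  With the choice
  \<open>p\<^sub>! = t\<^sup>*\<close>, the base change map of \<open>Der4\<close> at \<open>X\<close> is a composite of three arrows: \<open>t\<^sup>* pr\<^sup>* \<eta>\<close>,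
  which is the value of \<open>\<eta>\<close> at \<open>j\<close> since \<open>pr t = j\<close>; the restriction along \<open>t\<close> of the canonical
  transformation, whose component at \<open>t\<close> is the second entry \<open>id\<close> of \<open>(j, id)\<close>; and the counit, which
  is an identity.\<close>

lemma left_base_change_at_image:
  assumes J: "small_cat small J" and K: "small_cat small K" and u: "is_functor u J K"
    and ff: "fully_faithful u" and j: "j \<in> Obj J" and L: "left_kan D J K u L \<eta> \<epsilon>"
    and X: "X \<in> Obj (on_cat D J)"
  shows "is_iso (on_cat D pt_cat) (AMap (value_at D J j) (Cmp \<eta> X))"
proof -
  define k where "k = OMap u j"
  have k: "k \<in> Obj K"
    using functor_Obj[OF u j] by (simp add: k_def)
  interpret u: functor_at J K u k
    by unfold_locales (fact u k)+
  define T where "T = upair (j, Ident K k)"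
  note terminal = u.over_terminal[OF ff j k_def, folded T_def]
  have C: "small_cat small (over_cat u k)"
    by (rule u.small_cat_over[OF universe_axioms J K])
  interpret C: small_cat_at small D "over_cat u k" T
    by unfold_locales (fact C terminal(1))+
  interpret L: adjoint "on_cat D J" "on_cat D K" L "on_func D u" \<eta> \<epsilon>
    by (rule adjoint.intro) (use L in \<open>simp add: left_kan_def\<close>)
  let ?E = "on_cat D pt_cat" and ?Lp = "on_func D C.t" and ?pr = "on_func D (over_pr u k)"
  let ?\<epsilon>p = "id_nat (id_func ?E)"
  obtain \<eta>p where Lp: "left_kan D (over_cat u k) pt_cat C.p ?Lp \<eta>p ?\<epsilon>p"
    using C.left_kan_terminal[OF terminal(2)] by blast
  have E: "category ?E"
    by (rule functor_cat_Tgt[OF C.Dt])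
  note over = on_nat[OF C K u.nat_over]
  note eval_k = functor_value_at[OF K k] and eval_j = functor_value_at[OF J j]
  have Lp_pr: "?Lp \<circ>\<^sub>F ?pr = value_at D J j"
  proof -
    have "over_pr u k \<circ>\<^sub>F C.t = point J j"
      using C.c functor_comp_point[OF u.functor_over_pr C.c] by (simp add: over_pr_def mk_func_def T_def)
    then show ?thesis
      using on_func_comp[OF small_cat_pt C J C.t u.functor_over_pr] by (simp add: value_at_def)
  qed
  let ?v = "AMap (value_at D J j) (Cmp \<eta> X)"
  let ?LX = "OMap L X"
  note LX = functor_Obj[OF L.left X]
  have v: "?v \<in> Hom ?E (OMap (value_at D J j) X) (OMap (value_at D K k) ?LX)"
    using functor_Hom[OF eval_j L.unit_Hom[OF X]] value_at_comp[OF J K u j]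
      comp_OMap[OF L.right LX, of "value_at D J j"] by (simp add: k_def)
  have unit_part: "Cmp (id_nat (?Lp \<circ>\<^sub>F ?pr) \<star> \<eta>) X = ?v"
    unfolding Lp_pr by (rule whisker_left_Cmp[OF L.unit eval_j X])
  have over_part: "Cmp (id_nat ?Lp \<star> on_nat D (over_nat u k) \<star> id_nat L) X
      = Ident ?E (OMap (value_at D K k) ?LX)"
  proof -
    have T: "OMap (u \<circ>\<^sub>F over_pr u k) T = k" "OMap (point K k \<circ>\<^sub>F C.p) T = k"
      using C.c by (simp_all add: comp_OMap[OF u.functor_over_pr] comp_OMap[OF C.p])
        (simp add: over_pr_def mk_func_def T_def k_def)
    note over_t = nat_whisker_right[OF u.nat_over C.t,
        unfolded functor_comp_point[OF nat_functor_Src[OF u.nat_over] C.c] T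
          functor_comp_point[OF nat_functor_Tgt[OF u.nat_over] C.c]]
    note point_k = functor_point[OF u.K.category_axioms k]
    have "over_nat u k \<star> id_nat C.t = id_nat (point K k)"
    proof (rule nat_eqI[OF over_t nat_id[OF point_k]])
      fix a assume a: "a \<in> Obj (pt_cat :: ('a, 'a) cat)"
      have "Cmp (over_nat u k) T = Ident K k"
        using C.c mk_nat_Cmp[OF nat_functor_Src[OF u.nat_over]]
        by (simp add: over_nat_def functor_Tgt[OF u] T_def)
      then show "Cmp (over_nat u k \<star> id_nat C.t) a = Cmp (id_nat (point K k)) a"
        using a by (simp add: whisker_right_Cmp[OF u.nat_over C.t] id_nat_Cmp[OF point_k])
    qed
    then have "AMap ?Lp (Cmp (on_nat D (over_nat u k)) ?LX) = Ident ?E (OMap (value_at D K k) ?LX)"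
      using on_nat_whisker_right[OF small_cat_pt C K u.nat_over C.t LX]
        on_nat_id[OF small_cat_pt K point_k] id_nat_Cmp[OF eval_k LX] by (simp add: value_at_def)
    then show ?thesis
      using whisker_left_Cmp[OF nat_whisker_right[OF over L.left] C.Dt X]
        whisker_right_Cmp[OF over L.left X] by simp
  qed
  have counit_part: "Cmp (?\<epsilon>p \<star> id_nat (value_at D K k \<circ>\<^sub>F L)) X
      = Ident ?E (OMap (value_at D K k) ?LX)"
    using whisker_right_Cmp[OF nat_id[OF functor_id[OF E]] functor_comp[OF L.left eval_k] X]
      functor_Obj[OF eval_k LX]
    by (simp add: comp_OMap[OF L.left X] id_nat_Cmp[OF functor_id[OF E]] id_OMap)
  let ?\<beta> = "left_base_change D u k L \<eta> ?Lp ?\<epsilon>p"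
  have src: "NSrc (id_nat (?Lp \<circ>\<^sub>F ?pr) \<star> \<eta>) = value_at D J j"
    unfolding Lp_pr using nat_NSrc[OF nat_whisker_left[OF L.unit eval_j]] comp_id_right[OF eval_j] by simp
  have "Cmp ?\<beta> X = Ident ?E (OMap (value_at D K k) ?LX) \<cdot>\<^bsub>?E\<^esub>
      (Ident ?E (OMap (value_at D K k) ?LX) \<cdot>\<^bsub>?E\<^esub> ?v)"
    unfolding left_base_change_def functor_Tgt[OF u]
    by (simp add: vcomp_Cmp[OF _ eval_j X] vcomp_NSrc src unit_part over_part counit_part)
  also have "\<dots> = ?v"
    using category.Comp_Ident_left[OF E v] by simp
  finally show ?thesis
    using Der4_left[OF J K u k L Lp] X unfolding is_nat_iso_def by metis
qed

text \<open>Dually, \<open>(j, id)\<close> is initial in \<open>J\<^bsub>k/\<^esub>\<close>, so \<open>t\<^sup>*\<close> is now a choice of \<open>p\<^sub>*\<close> and its unit is an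
  identity.\<close>

lemma right_base_change_at_image:
  assumes J: "small_cat small J" and K: "small_cat small K" and u: "is_functor u J K"
    and ff: "fully_faithful u" and j: "j \<in> Obj J" and R: "right_kan D J K u R \<eta> \<epsilon>"
    and X: "X \<in> Obj (on_cat D J)"
  shows "is_iso (on_cat D pt_cat) (AMap (value_at D J j) (Cmp \<epsilon> X))"
proof -
  define k where "k = OMap u j"
  have k: "k \<in> Obj K"
    using functor_Obj[OF u j] by (simp add: k_def)
  interpret u: functor_at J K u k
    by unfold_locales (fact u k)+
  define T where "T = upair (j, Ident K k)"
  note initial = u.under_initial[OF ff j k_def, folded T_def]
  have C: "small_cat small (under_cat u k)"
    by (rule u.small_cat_under[OF universe_axioms J K])
  interpret C: small_cat_at small D "under_cat u k" T
    by unfold_locales (fact C initial(1))+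
  interpret R: adjoint "on_cat D K" "on_cat D J" "on_func D u" R \<eta> \<epsilon>
    by (rule adjoint.intro) (use R in \<open>simp add: right_kan_def\<close>)
  let ?E = "on_cat D pt_cat" and ?Rp = "on_func D C.t" and ?pr = "on_func D (under_pr u k)"
  let ?\<eta>p = "id_nat (id_func ?E)"
  obtain \<epsilon>p where Rp: "right_kan D (under_cat u k) pt_cat C.p ?Rp ?\<eta>p \<epsilon>p"
    using C.right_kan_initial[OF initial(2)] by blast
  have E: "category ?E"
    by (rule functor_cat_Tgt[OF C.Dt])
  note under = on_nat[OF C K u.nat_under]
  note eval_k = functor_value_at[OF K k] and eval_j = functor_value_at[OF J j]
  have Rp_pr: "?Rp \<circ>\<^sub>F ?pr = value_at D J j"
  proof -
    have "under_pr u k \<circ>\<^sub>F C.t = point J j"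
      using C.c functor_comp_point[OF u.functor_under_pr C.c] by (simp add: under_pr_def mk_func_def T_def)
    then show ?thesis
      using on_func_comp[OF small_cat_pt C J C.t u.functor_under_pr] by (simp add: value_at_def)
  qed
  let ?v = "AMap (value_at D J j) (Cmp \<epsilon> X)"
  let ?RX = "OMap R X"
  note RX = functor_Obj[OF R.right X]
  have v: "?v \<in> Hom ?E (OMap (value_at D K k) ?RX) (OMap (value_at D J j) X)"
    using functor_Hom[OF eval_j R.counit_Hom[OF X]] value_at_comp[OF J K u j]
      comp_OMap[OF R.left RX, of "value_at D J j"] by (simp add: k_def)
  have counit_part: "Cmp (id_nat (?Rp \<circ>\<^sub>F ?pr) \<star> \<epsilon>) X = ?v"
    unfolding Rp_pr by (rule whisker_left_Cmp[OF R.counit eval_j X])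
  have under_part: "Cmp (id_nat ?Rp \<star> on_nat D (under_nat u k) \<star> id_nat R) X
      = Ident ?E (OMap (value_at D K k) ?RX)"
  proof -
    have T: "OMap (u \<circ>\<^sub>F under_pr u k) T = k" "OMap (point K k \<circ>\<^sub>F C.p) T = k"
      using C.c by (simp_all add: comp_OMap[OF u.functor_under_pr] comp_OMap[OF C.p])
        (simp add: under_pr_def mk_func_def T_def k_def)
    note under_t = nat_whisker_right[OF u.nat_under C.t,
        unfolded functor_comp_point[OF nat_functor_Src[OF u.nat_under] C.c] T
          functor_comp_point[OF nat_functor_Tgt[OF u.nat_under] C.c]]
    note point_k = functor_point[OF u.K.category_axioms k]
    have "under_nat u k \<star> id_nat C.t = id_nat (point K k)"
    proof (rule nat_eqI[OF under_t nat_id[OF point_k]])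
      fix a assume a: "a \<in> Obj (pt_cat :: ('a, 'a) cat)"
      have "Cmp (under_nat u k) T = Ident K k"
        using C.c mk_nat_Cmp[OF nat_functor_Src[OF u.nat_under]]
        by (simp add: under_nat_def functor_Tgt[OF u] T_def)
      then show "Cmp (under_nat u k \<star> id_nat C.t) a = Cmp (id_nat (point K k)) a"
        using a by (simp add: whisker_right_Cmp[OF u.nat_under C.t] id_nat_Cmp[OF point_k])
    qed
    then have "AMap ?Rp (Cmp (on_nat D (under_nat u k)) ?RX) = Ident ?E (OMap (value_at D K k) ?RX)"
      using on_nat_whisker_right[OF small_cat_pt C K u.nat_under C.t RX]
        on_nat_id[OF small_cat_pt K point_k] id_nat_Cmp[OF eval_k RX] by (simp add: value_at_def)
    then show ?thesis
      using whisker_left_Cmp[OF nat_whisker_right[OF under R.right] C.Dt X]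
        whisker_right_Cmp[OF under R.right X] by simp
  qed
  have unit_part: "Cmp (?\<eta>p \<star> id_nat (value_at D K k \<circ>\<^sub>F R)) X
      = Ident ?E (OMap (value_at D K k) ?RX)"
    using whisker_right_Cmp[OF nat_id[OF functor_id[OF E]] functor_comp[OF R.right eval_k] X]
      functor_Obj[OF eval_k RX]
    by (simp add: comp_OMap[OF R.right X] id_nat_Cmp[OF functor_id[OF E]] id_OMap)
  let ?\<beta> = "right_base_change D u k R \<epsilon> ?Rp ?\<eta>p"
  note kR = functor_comp[OF R.right eval_k]
  have src: "NSrc (?\<eta>p \<star> id_nat (value_at D K k \<circ>\<^sub>F R)) = value_at D K k \<circ>\<^sub>F R"
    using nat_NSrc[OF nat_whisker_right[OF nat_id[OF functor_id[OF E]] kR]] comp_id_left[OF kR] by simp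
  have "Cmp ?\<beta> X = ?v \<cdot>\<^bsub>?E\<^esub>
      (Ident ?E (OMap (value_at D K k) ?RX) \<cdot>\<^bsub>?E\<^esub> Ident ?E (OMap (value_at D K k) ?RX))"
    unfolding right_base_change_def functor_Tgt[OF u]
    by (simp add: vcomp_Cmp[OF _ kR X] vcomp_NSrc src unit_part under_part counit_part)
  also have "\<dots> = ?v"
    using category.Comp_Ident_right[OF E v]
      category.Comp_Ident_left[OF E category.Ident_Hom[OF E functor_Obj[OF eval_k RX]]] by simp
  finally show ?thesis
    using Der4_right[OF J K u k R Rp] X unfolding is_nat_iso_def by metis
qed

lemma left_kan_unit_iso:
  assumes J: "small_cat small J" and "small_cat small K" "is_functor u J K" "fully_faithful u"
    and L: "left_kan D J K u L \<eta> \<epsilon>" and X: "X \<in> Obj (on_cat D J)"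
  shows "is_iso (on_cat D J) (Cmp \<eta> X)"
proof -
  have "Cmp \<eta> X \<in> Arr (on_cat D J)"
    using adjoint.unit_Hom[OF adjoint.intro[OF L[unfolded left_kan_def]] X] by (simp add: Hom_def)
  then show ?thesis
    using Der2[OF J] left_base_change_at_image[OF assms(1-4) _ L X] by blast
qed

lemma right_kan_counit_iso:
  assumes J: "small_cat small J" and "small_cat small K" "is_functor u J K" "fully_faithful u"
    and R: "right_kan D J K u R \<eta> \<epsilon>" and X: "X \<in> Obj (on_cat D J)"
  shows "is_iso (on_cat D J) (Cmp \<epsilon> X)"
proof -
  have "Cmp \<epsilon> X \<in> Arr (on_cat D J)"
    using adjoint.counit_Hom[OF adjoint.intro[OF R[unfolded right_kan_def]] X] by (simp add: Hom_def)
  then show ?thesis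
    using Der2[OF J] right_base_change_at_image[OF assms(1-4) _ R X] by blast
qed

end

section \<open>Vanishing outside the image\<close>

lemma prod_cat_Hom:
  "category A \<Longrightarrow> category B \<Longrightarrow>
    Hom (prod_cat A B) (a, b) (a', b') = Hom A a a' \<times> Hom B b b'"
  by (auto simp: prod_cat_def mk_cat_Hom) (auto simp: Hom_def)

lemma prod_cat_Comp:
  assumes "f \<in> Hom A a a'" "f' \<in> Hom A a' a''" "g \<in> Hom B b b'" "g' \<in> Hom B b' b''"
  shows "(f', g') \<cdot>\<^bsub>prod_cat A B\<^esub> (f, g) = (f' \<cdot>\<^bsub>A\<^esub> f, g' \<cdot>\<^bsub>B\<^esub> g)"
  using assms by (simp add: prod_cat_def Hom_def)

lemma prod_cat_simps [simp]:
  "Obj (prod_cat A B) = Obj A \<times> Obj B"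
  "a \<in> Obj A \<Longrightarrow> b \<in> Obj B \<Longrightarrow> Ident (prod_cat A B) (a, b) = (Ident A a, Ident B b)"
  by (simp_all add: prod_cat_def)

text \<open>Let \<open>G\<close> be a quasi-inverse of the diagonal.  Existence: \<open>(a, b)\<close> is isomorphic to \<open>(c, c)\<close> with
  \<open>c = G(a, b)\<close>, and \<open>a \<rightarrow> c \<rightarrow> b\<close> is an arrow.  Uniqueness: for arrows \<open>g, f : a \<rightarrow> b\<close>, the
  naturality square of the counit at \<open>(g, f)\<close> relates the one arrow \<open>G(g, f)\<close> to both \<open>g\<close> and \<open>f\<close>
  through isomorphisms that depend only on \<open>a\<close> and \<open>b\<close>.  Its second component expresses \<open>G(g, f)\<close>
  by \<open>f\<close> alone, and its first component then recovers \<open>g\<close>.  So \<open>g\<close> is determined by \<open>f\<close>, for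
  all \<open>g\<close>.\<close>

lemma diagonal_equivalence_Hom:
  assumes eq: "is_equivalence (pair_func (id_func C) (id_func C)) C (prod_cat C C)"
    and a: "a \<in> Obj C" and b: "b \<in> Obj C"
  shows "\<exists>!f. f \<in> Hom C a b"
proof -
  let ?F = "pair_func (id_func C) (id_func C)" and ?P = "prod_cat C C"
  have F: "is_functor ?F C ?P"
    using eq by (simp add: is_equivalence_def)
  obtain G \<epsilon> where G: "is_functor G ?P C" and \<epsilon>': "is_nat_iso \<epsilon> (?F \<circ>\<^sub>F G) (id_func ?P) ?P ?P"
    using eq by (auto simp: is_equivalence_def)
  then have \<epsilon>: "is_nat \<epsilon> (?F \<circ>\<^sub>F G) (id_func ?P) ?P ?P"
    by (simp add: is_nat_iso_def)
  interpret C: category C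
    by (rule functor_cat_Src[OF F])
  interpret P: category ?P
    by (rule functor_cat_Tgt[OF F])
  note hom = prod_cat_Hom[OF C.category_axioms C.category_axioms]
  have F_Obj: "OMap ?F x = (x, x)" if "x \<in> Obj C" for x
    using that by (simp add: pair_func_def mk_func_def id_func_def)
  have F_Arr: "AMap ?F f = (f, f)" if "f \<in> Arr C" for f
    using that by (simp add: pair_func_def mk_func_def id_func_def)
  have counit: "\<exists>x y x' y'. Cmp \<epsilon> (c, d) = (x, y) \<and> x \<in> Hom C (OMap G (c, d)) c \<and>
      y \<in> Hom C (OMap G (c, d)) d \<and> x' \<in> Hom C c (OMap G (c, d)) \<and> y' \<in> Hom C d (OMap G (c, d)) \<and>
      x' \<cdot>\<^bsub>C\<^esub> x = Ident C (OMap G (c, d)) \<and> y' \<cdot>\<^bsub>C\<^esub> y = Ident C (OMap G (c, d)) \<and>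
      x \<cdot>\<^bsub>C\<^esub> x' = Ident C c \<and> y \<cdot>\<^bsub>C\<^esub> y' = Ident C d"
    if cd: "c \<in> Obj C" "d \<in> Obj C" for c d
  proof -
    have cd': "(c, d) \<in> Obj ?P"
      using cd by simp
    have Gcd: "OMap G (c, d) \<in> Obj C"
      by (rule functor_Obj[OF G cd'])
    have h: "Cmp \<epsilon> (c, d) \<in> Hom ?P (OMap G (c, d), OMap G (c, d)) (c, d)"
      using nat_Hom[OF \<epsilon> cd'] by (simp add: comp_OMap[OF G cd'] id_OMap[OF cd'] F_Obj[OF Gcd])
    have "is_iso ?P (Cmp \<epsilon> (c, d))"
      using \<epsilon>' cd' by (auto simp: is_nat_iso_def)
    then obtain g where g: "g \<in> Hom ?P (c, d) (OMap G (c, d), OMap G (c, d))"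
        "g \<cdot>\<^bsub>?P\<^esub> Cmp \<epsilon> (c, d) = Ident ?P (OMap G (c, d), OMap G (c, d))"
        "Cmp \<epsilon> (c, d) \<cdot>\<^bsub>?P\<^esub> g = Ident ?P (c, d)"
      using P.is_iso_E[OF _ h] by blast
    obtain x y x' y' where xy: "Cmp \<epsilon> (c, d) = (x, y)" "g = (x', y')"
      by (metis surj_pair)
    have x: "x \<in> Hom C (OMap G (c, d)) c" "y \<in> Hom C (OMap G (c, d)) d"
        "x' \<in> Hom C c (OMap G (c, d))" "y' \<in> Hom C d (OMap G (c, d))"
      using h g(1) by (simp_all add: xy hom)
    then show ?thesis
      using g(2,3) xy cd Gcd prod_cat_Comp[OF x(1,3) x(2,4)] prod_cat_Comp[OF x(3,1) x(4,2)]
      by auto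
  qed
  show ?thesis
  proof (rule ex_ex1I)
    show "\<exists>f. f \<in> Hom C a b"
      using counit[OF a b] C.Comp_Hom by blast
  next
    fix f f' assume f: "f \<in> Hom C a b" and f': "f' \<in> Hom C a b"
    let ?a = "OMap G (a, a)" and ?b = "OMap G (b, b)"
    obtain x y x' where x: "Cmp \<epsilon> (a, a) = (x, y)" "x \<in> Hom C ?a a" "y \<in> Hom C ?a a"
        "x' \<in> Hom C a ?a" "x \<cdot>\<^bsub>C\<^esub> x' = Ident C a"
      using counit[OF a a] by blast
    obtain z w w' where z: "Cmp \<epsilon> (b, b) = (z, w)" "z \<in> Hom C ?b b" "w \<in> Hom C ?b b"
        "w' \<in> Hom C b ?b" "w' \<cdot>\<^bsub>C\<^esub> w = Ident C ?b"
      using counit[OF b b] by blast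
    have natural: "AMap G (g, f) \<in> Hom C ?a ?b \<and> z \<cdot>\<^bsub>C\<^esub> AMap G (g, f) = g \<cdot>\<^bsub>C\<^esub> x \<and>
        w \<cdot>\<^bsub>C\<^esub> AMap G (g, f) = f \<cdot>\<^bsub>C\<^esub> y" if g: "g \<in> Hom C a b" for g
    proof -
      have gf: "(g, f) \<in> Hom ?P (a, a) (b, b)"
        using f g by (simp add: hom)
      have Ggf: "AMap G (g, f) \<in> Hom C ?a ?b"
        by (rule functor_Hom[OF G gf])
      show ?thesis
        using nat_natural[OF \<epsilon> gf] Ggf prod_cat_Comp[OF Ggf z(2) Ggf z(3)]
          prod_cat_Comp[OF x(2) g x(3) f]
        by (simp add: comp_AMap[OF G P.Hom_Arr[OF gf]] id_AMap[OF P.Hom_Arr[OF gf]]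
            F_Arr[OF C.Hom_Arr[OF Ggf]] x(1) z(1))
    qed
    \<comment> \<open>the right-hand side does not mention \<open>g\<close>\<close>
    have "AMap G (g, f) = w' \<cdot>\<^bsub>C\<^esub> (f \<cdot>\<^bsub>C\<^esub> y)" if g: "g \<in> Hom C a b" for g
      using natural[OF g] C.Comp_assoc[OF _ z(3,4), of "AMap G (g, f)" ?a] z(5)
        C.Comp_Ident_left[of "AMap G (g, f)" ?a ?b] by simp
    then have "f \<cdot>\<^bsub>C\<^esub> x = f' \<cdot>\<^bsub>C\<^esub> x"
      using natural[OF f] natural[OF f'] f f' by metis
    then have "(f \<cdot>\<^bsub>C\<^esub> x) \<cdot>\<^bsub>C\<^esub> x' = (f' \<cdot>\<^bsub>C\<^esub> x) \<cdot>\<^bsub>C\<^esub> x'"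
      by simp
    then show "f = f'"
      using C.Comp_assoc[OF x(4,2) f] C.Comp_assoc[OF x(4,2) f'] x(5)
        C.Comp_Ident_right[OF f] C.Comp_Ident_right[OF f'] by simp
  qed
qed

lemma mk_cat_empty: "mk_cat {} {} d c i m = empty_cat"
  by (simp add: empty_cat_def mk_cat_def restrict_def)

lemma empty_cat_simps [simp]: "Obj empty_cat = {}" "Arr empty_cat = {}"
  by (simp_all add: empty_cat_def)

lemma (in functor_at) over_cat_empty:
  assumes "cosieve u" "k \<notin> OMap u ` Obj J"
  shows "over_cat u k = empty_cat"
proof -
  have "Hom K (OMap u j) k = {}" if "j \<in> Obj J" for j
    using assms that k by (auto simp only: cosieve_def functor_Src[OF u] functor_Tgt[OF u])
  then have obj: "over_obj u k = {}"
    unfolding over_obj_def functor_Src[OF u] functor_Tgt[OF u] by blast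
  then have "over_arr u k = {}"
    unfolding over_arr_def by blast
  with obj show ?thesis
    by (simp add: over_cat_def comma_on_def mk_cat_empty)
qed

lemma (in functor_at) under_cat_empty:
  assumes "sieve u" "k \<notin> OMap u ` Obj J"
  shows "under_cat u k = empty_cat"
proof -
  have "Hom K k (OMap u j) = {}" if "j \<in> Obj J" for j
    using assms that k by (auto simp only: sieve_def functor_Src[OF u] functor_Tgt[OF u])
  then have obj: "under_obj u k = {}"
    unfolding under_obj_def functor_Src[OF u] functor_Tgt[OF u] by blast
  then have "under_arr u k = {}"
    unfolding under_arr_def by blast
  with obj show ?thesis
    by (simp add: under_cat_def comma_on_def mk_cat_empty)
qed

context derivator
begin

lemma small_cat_empty: "small_cat small empty_cat"
proof -
  have "small {}"
    by (rule small_subset[OF small_doubleton empty_subsetI])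
  moreover have "category empty_cat"
    unfolding empty_cat_def by (rule category_mk_cat) auto
  ultimately show ?thesis
    by (simp add: small_cat_def)
qed

text \<open>The sum of the empty category with itself is empty, so \<open>Der1\<close> says that the diagonal of
  \<open>\<D>(\<emptyset>)\<close> is an equivalence.\<close>

lemma empty_Hom:
  assumes "X \<in> Obj (on_cat D empty_cat)" "Y \<in> Obj (on_cat D empty_cat)"
  shows "\<exists>!f. f \<in> Hom (on_cat D empty_cat) X Y"
proof -
  have sum: "sum_cat empty_cat empty_cat = (empty_cat :: ('a, 'a) cat)"
    by (simp add: sum_cat_def Plus_def mk_cat_empty)
  have "sum_inl empty_cat empty_cat = id_func (empty_cat :: ('a, 'a) cat)"
    "sum_inr empty_cat empty_cat = id_func (empty_cat :: ('a, 'a) cat)"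
    by (simp_all add: sum_inl_def sum_inr_def sum id_func_def mk_func_def restrict_def)
  then show ?thesis
    using diagonal_equivalence_Hom[OF _ assms] Der1_sum[OF small_cat_empty small_cat_empty]
    by (simp add: sum on_func_id[OF small_cat_empty])
qed

text \<open>By \<open>Der4\<close> the value at \<open>k\<close> is \<open>p\<^sub>!\<close> of an object of \<open>\<D>(\<emptyset>)\<close>.  Such an object is initial, and \<open>p\<^sub>!\<close>
  is a left adjoint.\<close>

lemma left_kan_vanishes:
  assumes J: "small_cat small J" and K: "small_cat small K" and u: "is_functor u J K"
    and cosieve: "cosieve u" and L: "left_kan D J K u L \<eta> \<epsilon>" and z: "zero_object (on_cat D pt_cat) z"
    and k: "k \<in> Obj K - OMap u ` Obj J" and X: "X \<in> Obj (on_cat D J)"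
  shows "isomorphic (on_cat D pt_cat) (OMap (value_at D K k) (OMap L X)) z"
proof -
  have kK: "k \<in> Obj K"
    using k by simp
  interpret u: functor_at J K u k
    by unfold_locales (fact u kK)+
  let ?E = "on_cat D pt_cat"
  have over_empty: "over_cat u k = empty_cat"
    using u.over_cat_empty cosieve k by simp
  have C: "small_cat small (over_cat u k)"
    by (rule u.small_cat_over[OF universe_axioms J K])
  note pr = on_func[OF C J u.functor_over_pr]
  have p: "is_functor (to_pt (over_cat u k)) (over_cat u k) pt_cat"
    by (rule functor_to_pt[OF small_cat_category[OF C]])
  obtain Lp \<eta>p \<epsilon>p where Lp: "left_kan D (over_cat u k) pt_cat (to_pt (over_cat u k)) Lp \<eta>p \<epsilon>p"
    using Der3_left[OF C small_cat_pt p] by blast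
  interpret Lp: adjoint "on_cat D (over_cat u k)" ?E Lp "on_func D (to_pt (over_cat u k))" \<eta>p \<epsilon>p
    by (rule adjoint.intro) (use Lp in \<open>simp add: left_kan_def\<close>)
  have L_functor: "is_functor L (on_cat D J) (on_cat D K)"
    using L by (simp add: left_kan_def adjunction_def)
  let ?pX = "OMap Lp (OMap (on_func D (over_pr u k)) X)"
  note prX = functor_Obj[OF pr X]
  have initial: "\<exists>!f. f \<in> Hom ?E ?pX Y" if "Y \<in> Obj ?E" for Y
    using Lp.left_preserves_initial[OF prX _ that] empty_Hom prX by (simp add: over_empty)
  have "is_nat_iso (left_base_change D u k L \<eta> Lp \<epsilon>p)
      (Lp \<circ>\<^sub>F on_func D (over_pr u k)) (value_at D K k \<circ>\<^sub>F L) (on_cat D J) ?E"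
    by (rule Der4_left[OF J K u kK L Lp])
  then have "isomorphic ?E ?pX (OMap (value_at D K k) (OMap L X))"
    using X nat_Hom[of "left_base_change D u k L \<eta> Lp \<epsilon>p"] comp_OMap[OF pr X, of Lp]
      comp_OMap[OF L_functor X, of "value_at D K k"]
    unfolding is_nat_iso_def isomorphic_def by metis
  moreover have "isomorphic ?E ?pX z"
    using z by (intro Lp.B.isomorphic_initial functor_Obj[OF Lp.left prX] initial)
      (simp_all add: zero_object_def)
  ultimately show ?thesis
    using Lp.B.isomorphic_trans[OF Lp.B.isomorphic_sym] by blast
qed

lemma right_kan_vanishes:
  assumes J: "small_cat small J" and K: "small_cat small K" and u: "is_functor u J K"
    and sieve: "sieve u" and R: "right_kan D J K u R \<eta> \<epsilon>" and z: "zero_object (on_cat D pt_cat) z"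
    and k: "k \<in> Obj K - OMap u ` Obj J" and X: "X \<in> Obj (on_cat D J)"
  shows "isomorphic (on_cat D pt_cat) (OMap (value_at D K k) (OMap R X)) z"
proof -
  have kK: "k \<in> Obj K"
    using k by simp
  interpret u: functor_at J K u k
    by unfold_locales (fact u kK)+
  let ?E = "on_cat D pt_cat"
  have under_empty: "under_cat u k = empty_cat"
    using u.under_cat_empty sieve k by simp
  have C: "small_cat small (under_cat u k)"
    by (rule u.small_cat_under[OF universe_axioms J K])
  note pr = on_func[OF C J u.functor_under_pr]
  have p: "is_functor (to_pt (under_cat u k)) (under_cat u k) pt_cat"
    by (rule functor_to_pt[OF small_cat_category[OF C]])
  obtain Rp \<eta>p \<epsilon>p where Rp: "right_kan D (under_cat u k) pt_cat (to_pt (under_cat u k)) Rp \<eta>p \<epsilon>p"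
    using Der3_right[OF C small_cat_pt p] by blast
  interpret Rp: adjoint ?E "on_cat D (under_cat u k)" "on_func D (to_pt (under_cat u k))" Rp \<eta>p \<epsilon>p
    by (rule adjoint.intro) (use Rp in \<open>simp add: right_kan_def\<close>)
  have R_functor: "is_functor R (on_cat D J) (on_cat D K)"
    using R by (simp add: right_kan_def adjunction_def)
  let ?pX = "OMap Rp (OMap (on_func D (under_pr u k)) X)"
  note prX = functor_Obj[OF pr X]
  have terminal: "\<exists>!f. f \<in> Hom ?E Y ?pX" if "Y \<in> Obj ?E" for Y
    using Rp.right_preserves_terminal[OF prX _ that] empty_Hom prX by (simp add: under_empty)
  have "is_nat_iso (right_base_change D u k R \<epsilon> Rp \<eta>p)
      (value_at D K k \<circ>\<^sub>F R) (Rp \<circ>\<^sub>F on_func D (under_pr u k)) (on_cat D J) ?E"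
    by (rule Der4_right[OF J K u kK R Rp])
  then have "isomorphic ?E (OMap (value_at D K k) (OMap R X)) ?pX"
    using X nat_Hom[of "right_base_change D u k R \<epsilon> Rp \<eta>p"] comp_OMap[OF pr X, of Rp]
      comp_OMap[OF R_functor X, of "value_at D K k"]
    unfolding is_nat_iso_def isomorphic_def by metis
  moreover have "isomorphic (op_cat ?E) ?pX z"
    using z terminal functor_Obj[OF Rp.right prX]
    by (intro category.isomorphic_initial[OF category_op[OF Rp.A.category_axioms]])
      (simp_all add: zero_object_def)
  ultimately show ?thesis
    unfolding isomorphic_op using Rp.A.isomorphic_trans Rp.A.isomorphic_sym by blast
qed

end

section \<open>Extension by zero\<close>

context derivator
begin

lemma left_kan_cosieve:
  assumes J: "small_cat small J" and K: "small_cat small K" and u: "is_functor u J K"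
    and cosieve: "cosieve u" and L: "left_kan D J K u L \<eta> \<epsilon>" and z: "zero_object (on_cat D pt_cat) z"
  shows "fully_faithful L"
    and "X \<in> Obj (on_cat D K) \<Longrightarrow> X \<in> essential_image L \<longleftrightarrow>
      (\<forall>k\<in>Obj K - OMap u ` Obj J. isomorphic (on_cat D pt_cat) (OMap (value_at D K k) X) z)"
proof -
  interpret adjoint "on_cat D J" "on_cat D K" L "on_func D u" \<eta> \<epsilon>
    by (rule adjoint.intro) (use L in \<open>simp add: left_kan_def\<close>)
  have ff: "fully_faithful u"
    using cosieve by (simp add: cosieve_def)
  note unit_iso = left_kan_unit_iso[OF J K u ff L]
  show "fully_faithful L"
    by (rule left_fully_faithful[OF unit_iso])
  assume X: "X \<in> Obj (on_cat D K)"
  show "X \<in> essential_image L \<longleftrightarrow>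
      (\<forall>k\<in>Obj K - OMap u ` Obj J. isomorphic (on_cat D pt_cat) (OMap (value_at D K k) X) z)"
  proof (rule left_essential_image[OF unit_iso functor_value_at[OF K] _ _ z _ X])
    show "is_iso (on_cat D K) f" if "f \<in> Arr (on_cat D K)"
      "\<And>k. k \<in> Obj K \<Longrightarrow> is_iso (on_cat D pt_cat) (AMap (value_at D K k) f)" for f
      using Der2[OF K] that by blast
  next
    fix k f assume "k \<in> OMap u ` Obj J" and f: "f \<in> Arr (on_cat D K)"
      and iso: "is_iso (on_cat D J) (AMap (on_func D u) f)"
    then obtain j where j: "j \<in> Obj J" "k = OMap u j"
      by blast
    show "is_iso (on_cat D pt_cat) (AMap (value_at D K k) f)"
      using functor_is_iso[OF functor_value_at[OF J j(1)] iso] value_at_comp[OF J K u j(1)]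
        comp_AMap[OF right f, of "value_at D J j"] j(2) by simp
  next
    show "isomorphic (on_cat D pt_cat) (OMap (value_at D K k) (OMap L A)) z"
      if "k \<in> Obj K - OMap u ` Obj J" "A \<in> Obj (on_cat D J)" for k A
      by (rule left_kan_vanishes[OF J K u cosieve L z that])
  qed
qed

lemma right_kan_sieve:
  assumes J: "small_cat small J" and K: "small_cat small K" and u: "is_functor u J K"
    and sieve: "sieve u" and R: "right_kan D J K u R \<eta> \<epsilon>" and z: "zero_object (on_cat D pt_cat) z"
  shows "fully_faithful R"
    and "X \<in> Obj (on_cat D K) \<Longrightarrow> X \<in> essential_image R \<longleftrightarrow>
      (\<forall>k\<in>Obj K - OMap u ` Obj J. isomorphic (on_cat D pt_cat) (OMap (value_at D K k) X) z)"
proof -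
  interpret adjoint "on_cat D K" "on_cat D J" "on_func D u" R \<eta> \<epsilon>
    by (rule adjoint.intro) (use R in \<open>simp add: right_kan_def\<close>)
  have ff: "fully_faithful u"
    using sieve by (simp add: sieve_def)
  note counit_iso = right_kan_counit_iso[OF J K u ff R]
  show "fully_faithful R"
    by (rule right_fully_faithful[OF counit_iso])
  assume X: "X \<in> Obj (on_cat D K)"
  show "X \<in> essential_image R \<longleftrightarrow>
      (\<forall>k\<in>Obj K - OMap u ` Obj J. isomorphic (on_cat D pt_cat) (OMap (value_at D K k) X) z)"
  proof (rule right_essential_image[OF counit_iso functor_value_at[OF K] _ _ z _ X])
    show "is_iso (on_cat D K) f" if "f \<in> Arr (on_cat D K)"
      "\<And>k. k \<in> Obj K \<Longrightarrow> is_iso (on_cat D pt_cat) (AMap (value_at D K k) f)" for f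
      using Der2[OF K] that by blast
  next
    fix k f assume "k \<in> OMap u ` Obj J" and f: "f \<in> Arr (on_cat D K)"
      and iso: "is_iso (on_cat D J) (AMap (on_func D u) f)"
    then obtain j where j: "j \<in> Obj J" "k = OMap u j"
      by blast
    show "is_iso (on_cat D pt_cat) (AMap (value_at D K k) f)"
      using functor_is_iso[OF functor_value_at[OF J j(1)] iso] value_at_comp[OF J K u j(1)]
        comp_AMap[OF left f, of "value_at D J j"] j(2) by simp
  next
    show "isomorphic (on_cat D pt_cat) (OMap (value_at D K k) (OMap R A)) z"
      if "k \<in> Obj K - OMap u ` Obj J" "A \<in> Obj (on_cat D J)" for k A
      by (rule right_kan_vanishes[OF J K u sieve R z that])
  qed
qed

end

theorem proposition3p6:
  fixes small :: "'u :: infinite set \<Rightarrow> bool" and D :: "('u, 'o, 'm) prederiv" and Z :: 'o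
  assumes "pointed_derivator small D" and "zero_object (on_cat D pt_cat) Z"
  shows "(\<forall>J K u L \<eta> \<epsilon>.
      small_cat small J \<and> small_cat small K \<and> is_functor u J K \<and> cosieve u \<and>
      left_kan D J K u L \<eta> \<epsilon> \<longrightarrow>
        fully_faithful L \<and>
        (\<forall>X\<in>Obj (on_cat D K). X \<in> essential_image L \<longleftrightarrow>
          (\<forall>k\<in>Obj K - OMap u ` Obj J.
            isomorphic (on_cat D pt_cat) (OMap (value_at D K k) X) Z))) \<and>
    (\<forall>J K u R \<eta> \<epsilon>.
      small_cat small J \<and> small_cat small K \<and> is_functor u J K \<and> sieve u \<and>
      right_kan D J K u R \<eta> \<epsilon> \<longrightarrow>
        fully_faithful R \<and>
        (\<forall>X\<in>Obj (on_cat D K). X \<in> essential_image R \<longleftrightarrow>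
          (\<forall>k\<in>Obj K - OMap u ` Obj J.
            isomorphic (on_cat D pt_cat) (OMap (value_at D K k) X) Z)))"
proof -
  interpret derivator small D
    using assms(1) by (simp add: pointed_derivator_def)
  show ?thesis
    by (intro conjI allI impI ballI; elim conjE;
      rule left_kan_cosieve[OF _ _ _ _ _ assms(2)] right_kan_sieve[OF _ _ _ _ _ assms(2)]; assumption)
qed

end
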